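(* For any $g>0$, $\kappa\ge0$, $h\in(0,+\infty]$, $\gamma\in\mathbb R$, $j_*\in\mathbb Z\setminus\{0\}$, let $c_*=\Omega_{j_*}/j_*$. If (i) either $h<\infty$, $\kappa>0$ and the vorticity-modified Bond numbers fulfill $B_+<\frac13$ if $c_*>0$, and $B_-<\frac13$ if $c_*<0$; (ii) or $h=+\infty$ and $\kappa>0$; then the kernel of the operator $\mathcal L_{c_*}$ has (real) dimension either two or four. In all other cases $\dim\ker\mathcal L_{c_*}=2$. Moreover, for any pair of integers $j_*,j$ with $1\le|j_*|<|j|$ and $\operatorname{sign}(j)=\operatorname{sign}(j_* )$, and for any $g>0$, $h\in(0,+\infty]$, $\gamma\in\mathbb R$, there exists $\kappa>0$ such that $\frac{\Omega_j}{j}=\frac{\Omega_{j_*}}{j_*}=c_*$; in particular, $\dim\ker\mathcal L_{c_*}=4$.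
   Context: Dispersion relation: for $\xi\ne0$, $\Omega_\xi=\Omega_\xi(g,h,\kappa,\gamma)$ is $\frac\gamma2\tanh(h\xi)+\sqrt{(g+\kappa\xi^2)\xi\tanh(h\xi)+\frac{\gamma^2}4\tanh^2(h\xi)}$ if $h<+\infty$, and $\frac\gamma2\operatorname{sign}(\xi)+\sqrt{(g+\kappa\xi^2)|\xi|+\frac{\gamma^2}4}$ if $h=+\infty$. Vorticity-modified Bond numbers, for $h<+\infty$: $$B_\pm=B_\pm(g,h,\kappa,\gamma)=\frac{\kappa}{gh^2}-\frac{h\gamma^2}{6g}\Big(1\pm\sqrt{1+\frac{4g}{h\gamma^2}}\Big),$$ which reduce to $B_\pm=\kappa/(gh^2)$ in the irrotational case $\gamma=0$. Linearized operator: $\mathbb T=\mathbb R/(2\pi\mathbb Z)$; for $\sigma>0$, $H^{\sigma,s}$ is the space of real $2\pi$-periodic functions $\sum_ku_ke^{ikx}$ with $\sum_k|u_k|^2\max\{1,|k|\}^{2s}e^{2\sigma|k|}<\infty$, and $H_0^{\sigma,s}$ its subspace of zero average functions; fix $\sigma>0$, $s\ge7/2$ with $s+\frac12\in\mathbb N$ and set $X=H^{\sigma,s}\times H_0^{\sigma,s}$. For $c\in\mathbb R$ the operator $\mathcal L_c$, with domain $X$, is the linearization at the flat surface of the gravity-capillary water waves equations with gravity $g$, depth $h$, surface tension $\kappa$ and constant vorticity $\gamma$ in a frame moving with speed $c$: $$\mathcal L_c=c\,\partial_x+\begin{pmatrix}0&I\\-I&0\end{pmatrix}\begin{pmatrix}g-\kappa\partial_x^2-\frac{\gamma^2}{4}\Pi_0^\perp\partial_x^{-1}G(0)\partial_x^{-1}\Pi_0^\perp&-\frac\gamma2\Pi_0^\perp\partial_x^{-1}G(0)\\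 \frac\gamma2G(0)\partial_x^{-1}\Pi_0^\perp&G(0)\end{pmatrix},$$ where $G(0)$ is the Fourier multiplier with symbol $\xi\tanh(h\xi)$ if $h<\infty$ and $|\xi|$ if $h=+\infty$, $\Pi_0^\perp$ is the projector onto zero average functions and $\partial_x^{-1}$ is the inverse of $\partial_x$ on zero average functions.
   Formalization: The square root in B_± is multiplied by sign(γ), which swaps B_+ and B_- when γ<0; as printed, "in all other cases dim = 2" fails for γ<0, c_*<0 (e.g. g=h=1, γ=-4, j_*=-1, κ≈4.086, where B_-≈4.40 but the kernel has dimension 4). *)

theory Defs
  imports "HOL-Analysis.Analysis" "HOL-Library.Function_Algebras"
begin

text \<open>
  Real-valued functions form a real vector space under pointwise operations, so that the library
  constant \<^const>\<open>dim\<close> can be used for subspaces of pairs of functions. It is \<open>0\<close> on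
  infinite-dimensional subspaces, so \<open>dim V = 2\<close> or \<open>dim V = 4\<close> includes finite dimensionality.
\<close>

instantiation "fun" :: (type, real_vector) real_vector
begin

definition scaleR_fun :: "real \<Rightarrow> ('a \<Rightarrow> 'b) \<Rightarrow> 'a \<Rightarrow> 'b"
  where "scaleR_fun r f = (\<lambda>x. r *\<^sub>R f x)"

instance
  by standard (simp_all add: scaleR_fun_def fun_eq_iff scaleR_add_right scaleR_add_left)

end

text \<open>The depth \<open>h\<close> ranges over \<open>(0, \<infinity>]\<close> and is an extended real.\<close>

definition Omega :: "real \<Rightarrow> ereal \<Rightarrow> real \<Rightarrow> real \<Rightarrow> real \<Rightarrow> real" where
  "Omega g h \<kappa> \<gamma> \<xi> =
    (if h = \<infinity>
     then \<gamma> / 2 * sgn \<xi> + sqrt ((g + \<kappa> * \<xi>\<^sup>2) * \<bar>\<xi>\<bar> + \<gamma>\<^sup>2 / 4)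
     else (let t = tanh (real_of_ereal h * \<xi>)
           in \<gamma> / 2 * t + sqrt ((g + \<kappa> * \<xi>\<^sup>2) * \<xi> * t + \<gamma>\<^sup>2 / 4 * t\<^sup>2)))"

text \<open>
  The square root carries the factor \<open>sgn \<gamma>\<close>, that is, \<open>\<gamma>\<^sup>2 sqrt (1 + 4g/(h\<gamma>\<^sup>2))\<close> is read as
  \<open>\<gamma> sqrt (\<gamma>\<^sup>2 + 4g/h)\<close>. For \<open>\<gamma> \<ge> 0\<close> this is the customary formula without the sign (see the
  lemmas below); for \<open>\<gamma> < 0\<close> it exchanges the roles of \<open>B\<^sub>+\<close> and \<open>B\<^sub>-\<close>. The signed reading is
  the one for which \<open>B\<^sub>+ < 1/3\<close> (resp. \<open>B\<^sub>- < 1/3\<close>) governs waves of positive (resp. negative)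
  speed for both signs of the vorticity: \<open>\<xi> \<mapsto> \<Omega>\<^sub>\<xi>/\<xi>\<close> has negative second-order coefficient at
  \<open>\<xi> \<rightarrow> 0+\<close> iff \<open>\<kappa>/(gh\<^sup>2) - h\<gamma>\<^sup>2/(6g) - \<gamma>h/(6g) sqrt (\<gamma>\<^sup>2 + 4g/h) < 1/3\<close>, and passing to
  negative speeds replaces \<open>\<gamma>\<close> by \<open>-\<gamma>\<close>. With the unsigned formula the assertion that the kernel is
  two-dimensional for \<open>B\<^sub>- \<ge> 1/3\<close> is false for \<open>\<gamma> < 0\<close> and negative speed, for example for
  \<open>g = h = 1\<close>, \<open>\<gamma> = -4\<close> and \<open>\<kappa>\<close> (about \<open>4.09\<close>) such that the modes \<open>-1\<close>, \<open>-2\<close> are resonant.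
\<close>

definition Bond_plus :: "real \<Rightarrow> real \<Rightarrow> real \<Rightarrow> real \<Rightarrow> real" where
  "Bond_plus g h \<kappa> \<gamma> =
    \<kappa> / (g * h\<^sup>2) - h * \<gamma>\<^sup>2 / (6 * g) * (1 + sgn \<gamma> * sqrt (1 + 4 * g / (h * \<gamma>\<^sup>2)))"

definition Bond_minus :: "real \<Rightarrow> real \<Rightarrow> real \<Rightarrow> real \<Rightarrow> real" where
  "Bond_minus g h \<kappa> \<gamma> =
    \<kappa> / (g * h\<^sup>2) - h * \<gamma>\<^sup>2 / (6 * g) * (1 - sgn \<gamma> * sqrt (1 + 4 * g / (h * \<gamma>\<^sup>2)))"

lemma Bond_nonneg_vorticity:
  assumes "\<gamma> \<ge> 0"
  shows "Bond_plus g h \<kappa> \<gamma> =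
      \<kappa> / (g * h\<^sup>2) - h * \<gamma>\<^sup>2 / (6 * g) * (1 + sqrt (1 + 4 * g / (h * \<gamma>\<^sup>2)))"
    and "Bond_minus g h \<kappa> \<gamma> =
      \<kappa> / (g * h\<^sup>2) - h * \<gamma>\<^sup>2 / (6 * g) * (1 - sqrt (1 + 4 * g / (h * \<gamma>\<^sup>2)))"
  using assms by (cases "\<gamma> = 0"; simp add: Bond_plus_def Bond_minus_def)+

lemma Bond_irrotational:
  "Bond_plus g h \<kappa> 0 = \<kappa> / (g * h\<^sup>2)" "Bond_minus g h \<kappa> 0 = \<kappa> / (g * h\<^sup>2)"
  by (simp_all add: Bond_plus_def Bond_minus_def)

definition periodic :: "(real \<Rightarrow> 'a) \<Rightarrow> bool" where
  "periodic u \<longleftrightarrow> (\<forall>x. u (x + 2 * pi) = u x)"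

definition mean :: "(real \<Rightarrow> real) \<Rightarrow> real" where
  "mean u = integral {0..2 * pi} u / (2 * pi)"

definition fourier_coeff :: "(real \<Rightarrow> real) \<Rightarrow> int \<Rightarrow> complex" where
  "fourier_coeff u k =
    integral {0..2 * pi} (\<lambda>x. complex_of_real (u x) * cis (- (of_int k * x))) / (2 * pi)"

definition Hspace :: "real \<Rightarrow> real \<Rightarrow> (real \<Rightarrow> real) set" where
  "Hspace \<sigma> s = {u. periodic u
     \<and> (\<forall>x. ((\<lambda>k. fourier_coeff u k * cis (of_int k * x)) has_sum complex_of_real (u x)) UNIV)
     \<and> (\<lambda>k::int. (cmod (fourier_coeff u k))\<^sup>2 * (max 1 \<bar>real_of_int k\<bar>) powr (2 * s)
            * exp (2 * \<sigma> * \<bar>real_of_int k\<bar>)) summable_on UNIV}"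

definition Hspace0 :: "real \<Rightarrow> real \<Rightarrow> (real \<Rightarrow> real) set" where
  "Hspace0 \<sigma> s = {u \<in> Hspace \<sigma> s. mean u = 0}"

text \<open>
  The symbol \<open>m\<close> is real and, in the application below, even, so that the series is real-valued for
  real \<open>u\<close>; taking the real part only adjusts the type.
\<close>

definition fourier_multiplier :: "(real \<Rightarrow> real) \<Rightarrow> (real \<Rightarrow> real) \<Rightarrow> real \<Rightarrow> real" where
  "fourier_multiplier m u =
    (\<lambda>x. Re (\<Sum>\<^sub>\<infinity>k\<in>UNIV. complex_of_real (m (of_int k)) * fourier_coeff u k * cis (of_int k * x)))"

definition G0 :: "ereal \<Rightarrow> (real \<Rightarrow> real) \<Rightarrow> real \<Rightarrow> real" where
  "G0 h = fourier_multiplier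
    (\<lambda>\<xi>. if h = \<infinity> then \<bar>\<xi>\<bar> else \<xi> * tanh (real_of_ereal h * \<xi>))"

definition proj0 :: "(real \<Rightarrow> real) \<Rightarrow> real \<Rightarrow> real" where
  "proj0 u = (\<lambda>x. u x - mean u)"

definition dx_inv :: "(real \<Rightarrow> real) \<Rightarrow> real \<Rightarrow> real" where
  "dx_inv = inv_into {v. periodic v \<and> (\<forall>x. v differentiable (at x)) \<and> mean v = 0} deriv"

definition hessian_op :: "real \<Rightarrow> ereal \<Rightarrow> real \<Rightarrow> real \<Rightarrow>
    (real \<Rightarrow> real) \<times> (real \<Rightarrow> real) \<Rightarrow> (real \<Rightarrow> real) \<times> (real \<Rightarrow> real)" where
  "hessian_op g h \<kappa> \<gamma> = (\<lambda>(\<eta>, \<psi>).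
    (g *\<^sub>R \<eta> - \<kappa> *\<^sub>R deriv (deriv \<eta>)
       - (\<gamma>\<^sup>2 / 4) *\<^sub>R proj0 (dx_inv (G0 h (dx_inv (proj0 \<eta>))))
       - (\<gamma> / 2) *\<^sub>R proj0 (dx_inv (G0 h \<psi>)),
     (\<gamma> / 2) *\<^sub>R G0 h (dx_inv (proj0 \<eta>)) + G0 h \<psi>))"

definition symplectic_J ::
    "(real \<Rightarrow> real) \<times> (real \<Rightarrow> real) \<Rightarrow> (real \<Rightarrow> real) \<times> (real \<Rightarrow> real)" where
  "symplectic_J = (\<lambda>(u, v). (v, - u))"

definition Lop :: "real \<Rightarrow> ereal \<Rightarrow> real \<Rightarrow> real \<Rightarrow> real \<Rightarrow>
    (real \<Rightarrow> real) \<times> (real \<Rightarrow> real) \<Rightarrow> (real \<Rightarrow> real) \<times> (real \<Rightarrow> real)" where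
  "Lop g h \<kappa> \<gamma> c u =
    c *\<^sub>R (deriv (fst u), deriv (snd u)) + symplectic_J (hessian_op g h \<kappa> \<gamma> u)"

definition kerL :: "real \<Rightarrow> real \<Rightarrow> real \<Rightarrow> ereal \<Rightarrow> real \<Rightarrow> real \<Rightarrow> real \<Rightarrow>
    ((real \<Rightarrow> real) \<times> (real \<Rightarrow> real)) set" where
  "kerL \<sigma> s g h \<kappa> \<gamma> c = {u \<in> Hspace \<sigma> s \<times> Hspace0 \<sigma> s. Lop g h \<kappa> \<gamma> c u = 0}"

definition case_i :: "real \<Rightarrow> ereal \<Rightarrow> real \<Rightarrow> real \<Rightarrow> real \<Rightarrow> bool" where
  "case_i g h \<kappa> \<gamma> c \<longleftrightarrow> h < \<infinity> \<and> \<kappa> > 0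
     \<and> (c > 0 \<longrightarrow> Bond_plus g (real_of_ereal h) \<kappa> \<gamma> < 1/3)
     \<and> (c < 0 \<longrightarrow> Bond_minus g (real_of_ereal h) \<kappa> \<gamma> < 1/3)"

definition case_ii :: "ereal \<Rightarrow> real \<Rightarrow> bool" where
  "case_ii h \<kappa> \<longleftrightarrow> h = \<infinity> \<and> \<kappa> > 0"

end

theory Submission
  imports Defs
begin

text \<open>
  On the Fourier mode \<open>k \<noteq> 0\<close> the operator acts as a \<open>2 \<times> 2\<close> matrix of rank at least one, and its
  determinant vanishes iff \<open>c\<^sup>2 k = t\<^sub>k (c\<gamma> + g + \<kappa>k\<^sup>2)\<close>, where \<open>t\<^sub>k = tanh (hk)\<close> (\<open>sgn k\<close> for infinite
  depth). The condition is even in \<open>k\<close> and each solution \<open>k > 0\<close> contributes two real dimensions, so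
  the kernel has twice as many dimensions as this equation has positive integer solutions.

  With \<open>x = hk\<close> the equation says that \<open>(c\<^sup>2/h) x coth x - (\<kappa>/h\<^sup>2) x\<^sup>2\<close> equals the constant
  \<open>c\<gamma> + g\<close>. The derivative of \<open>x coth x\<close> with respect to \<open>x\<^sup>2\<close> decreases strictly from its limit
  \<open>1/3\<close> at \<open>0\<close>, so by the mean value theorem there are at most two solutions. If there are two, then
  \<open>0 < \<kappa> < c\<^sup>2h/3\<close> and \<open>c\<^sup>2 \<le> h(c\<gamma> + g)\<close>; the latter bounds \<open>c\<close> by the long wave speed, and
  inserting that bound in the former is the condition on the Bond number.

  Two prescribed solutions \<open>x < y\<close> give two equations that are linear in \<open>\<kappa>\<close>; eliminating \<open>\<kappa>\<close> leaves
  a quadratic equation for \<open>c\<close> with a positive root.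
\<close>

section \<open>The function \<open>x coth x\<close>\<close>

lemma less_sinh: "x < sinh x" if "x > 0" for x :: real
proof -
  have "(\<lambda>x. sinh x - x) 0 < (\<lambda>x::real. sinh x - x) x"
  proof (rule DERIV_pos_imp_increasing_open[OF that])
    fix y :: real assume "0 < y" "y < x"
    have "((\<lambda>x. sinh x - x) has_real_derivative cosh y - 1) (at y)"
      by (auto intro!: derivative_eq_intros)
    moreover have "cosh y > 1" using \<open>0 < y\<close> cosh_real_strict_mono[of 0 y] by simp
    ultimately show "\<exists>d. ((\<lambda>x. sinh x - x) has_real_derivative d) (at y) \<and> d > 0"
      by (intro exI[of _ "cosh y - 1"]) auto
  qed (intro continuous_intros)
  thus ?thesis by simp
qed

lemma sinh_less_mult_cosh: "sinh x < x * cosh x" if "x > 0" for x :: real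
proof -
  have "(\<lambda>x. x * cosh x - sinh x) 0 < (\<lambda>x::real. x * cosh x - sinh x) x"
  proof (rule DERIV_pos_imp_increasing_open[OF that])
    fix y :: real assume "0 < y" "y < x"
    have "((\<lambda>x. x * cosh x - sinh x) has_real_derivative y * sinh y) (at y)"
      by (auto intro!: derivative_eq_intros)
    thus "\<exists>d. ((\<lambda>x. x * cosh x - sinh x) has_real_derivative d) (at y) \<and> d > 0"
      using \<open>0 < y\<close> by (intro exI[of _ "y * sinh y"]) auto
  qed (intro continuous_intros)
  thus ?thesis by simp
qed

lemma sinh_cosh_gt: "x < sinh x * cosh x" if "x > 0" for x :: real
proof -
  have "sinh x * 1 \<le> sinh x * cosh x"
    by (rule mult_left_mono[OF cosh_real_ge_1]) (use that in simp)
  thus ?thesis using less_sinh[OF that] that by linarith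
qed

lemma tanh_has_real_derivative: "(tanh has_real_derivative 1 - tanh x ^ 2) (at x)"
  for x :: real
  using has_field_derivative_tanh[OF _ DERIV_ident, of x UNIV] by simp

lemmas hyp_deriv_rules = tanh_has_real_derivative DERIV_add DERIV_diff DERIV_mult DERIV_power
  DERIV_ident DERIV_const has_field_derivative_sinh[OF DERIV_ident]
  has_field_derivative_cosh[OF DERIV_ident]

lemma mult_tanh_less_sinh_sq: "x * tanh x < sinh x ^ 2" if "x > 0" for x :: real
proof -
  have "x * sinh x < sinh x * cosh x * sinh x"
    using sinh_cosh_gt[OF that] that by (intro mult_strict_right_mono) auto
  thus ?thesis
    by (simp add: tanh_def field_simps power2_eq_square)
qed

text \<open>This is the sign condition behind the strict decrease of \<open>xcoth_slope\<close>. The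
  difference of the two sides and its first derivative vanish at 0, so a positive second derivative
  suffices; \<open>mult_tanh_less_sinh_sq\<close> provides it.\<close>

lemma two_sq_less_tanh_sinh: "2 * x ^ 2 < x * tanh x + sinh x ^ 2" if "x > 0" for x :: real
proof -
  \<comment> \<open>The derivative of \<open>x * tanh x + sinh x ^ 2 - 2 * x ^ 2\<close>.\<close>
  define P' where "P' = (\<lambda>x::real. tanh x + x * (1 - tanh x ^ 2) + 2 * sinh x * cosh x - 4 * x)"
  have P': "P' y > 0" if "y > 0" for y
  proof -
    have "P' 0 < P' y"
    proof (rule DERIV_pos_imp_increasing_open[OF that])
      fix z :: real assume z: "0 < z" "z < y"
      define S where "S = sinh z ^ 2"
      have S: "S > 0" using z by (simp add: S_def)
      have q: "1 - tanh z ^ 2 = 1 / (1 + S)"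
      proof -
        have "tanh z ^ 2 = S / (1 + S)"
          using cosh_square_eq[of z] by (simp add: tanh_def S_def power_divide)
        thus ?thesis using S by (simp add: field_simps)
      qed
      define d where "d = 2 * (1 - z * tanh z) * (1 - tanh z ^ 2) + 2 * (cosh z ^ 2 + sinh z ^ 2) - 4"
      have "(P' has_real_derivative d) (at z)"
        unfolding P'_def d_def
        by ((rule DERIV_cong), (rule hyp_deriv_rules)+)
          (simp add: algebra_simps power2_eq_square)
      moreover have "d > 0"
      proof -
        have *: "2 * a + 2 * (1 + 2 * S) - 4 < 2 * b + 2 * (S + 1 + S) - 4" if "a < b" for a b
          using that by simp
        \<comment> \<open>Replacing \<open>z * tanh z\<close> by the larger \<open>S\<close> bounds
          the second derivative \<open>d\<close> from below by an expression in \<open>S\<close>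
          alone, which simplifies to \<open>4 * S ^ 2 / (1 + S)\<close>.\<close>
        have "(1 - S) * (1 / (1 + S)) < (1 - z * tanh z) * (1 / (1 + S))"
          using mult_tanh_less_sinh_sq[OF z(1)] S
          by (intro mult_strict_right_mono divide_pos_pos add_pos_pos) (simp_all add: S_def)
        hence "d > 2 * ((1 - S) * (1 / (1 + S))) + 2 * (1 + 2 * S) - 4"
          unfolding d_def q cosh_square_eq S_def[symmetric] mult.assoc by (rule *)
        also have "2 * ((1 - S) * (1 / (1 + S))) + 2 * (1 + 2 * S) - 4 = 4 * S ^ 2 / (1 + S)"
          using S by (simp add: field_simps power2_eq_square)
        finally show ?thesis using S by (smt (verit) divide_nonneg_pos zero_le_power2)
      qed
      ultimately show "\<exists>d. (P' has_real_derivative d) (at z) \<and> d > 0" by blast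
    qed (unfold P'_def, intro continuous_intros, auto)
    thus ?thesis by (simp add: P'_def)
  qed
  have "(\<lambda>x. x * tanh x + sinh x ^ 2 - 2 * x ^ 2) 0
      < (\<lambda>x::real. x * tanh x + sinh x ^ 2 - 2 * x ^ 2) x"
  proof (rule DERIV_pos_imp_increasing_open[OF that])
    fix y :: real assume y: "0 < y" "y < x"
    have "((\<lambda>x. x * tanh x + sinh x ^ 2 - 2 * x ^ 2) has_real_derivative P' y) (at y)"
      unfolding P'_def
        by ((rule DERIV_cong), (rule hyp_deriv_rules)+)
          (simp add: algebra_simps power2_eq_square)
    thus "\<exists>d. ((\<lambda>x. x * tanh x + sinh x ^ 2 - 2 * x ^ 2) has_real_derivative d) (at y) \<and> d > 0"
      using P'[OF y(1)] by blast
  qed (intro continuous_intros, auto)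
  thus ?thesis by simp
qed

text \<open>Two differentiations reduce the claim to \<open>sinh_less_mult_cosh\<close>. Evaluated
  at \<open>2 * x\<close>, it bounds \<open>xcoth_slope\<close> by its limit 1/3 at 0.\<close>

lemma sinh_less_third: "3 * sinh x < x * cosh x + 2 * x" if "x > 0" for x :: real
proof -
  have *: "(\<lambda>x. x * sinh x + 2 - 2 * cosh x) 0 < (\<lambda>x::real. x * sinh x + 2 - 2 * cosh x) x"
    if "x > 0" for x
  proof (rule DERIV_pos_imp_increasing_open[OF that])
    fix y :: real assume y: "0 < y" "y < x"
    have "((\<lambda>x. x * sinh x + 2 - 2 * cosh x) has_real_derivative y * cosh y - sinh y) (at y)"
      by (auto intro!: derivative_eq_intros)
    thus "\<exists>d. ((\<lambda>x. x * sinh x + 2 - 2 * cosh x) has_real_derivative d) (at y) \<and> d > 0"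
      using sinh_less_mult_cosh[OF y(1)] by (intro exI[of _ "y * cosh y - sinh y"]) auto
  qed (intro continuous_intros)
  have "(\<lambda>x. x * cosh x + 2 * x - 3 * sinh x) 0 < (\<lambda>x::real. x * cosh x + 2 * x - 3 * sinh x) x"
  proof (rule DERIV_pos_imp_increasing_open[OF that])
    fix y :: real assume y: "0 < y" "y < x"
    have "((\<lambda>x. x * cosh x + 2 * x - 3 * sinh x) has_real_derivative y * sinh y + 2 - 2 * cosh y) (at y)"
      by (auto intro!: derivative_eq_intros)
    thus "\<exists>d. ((\<lambda>x. x * cosh x + 2 * x - 3 * sinh x) has_real_derivative d) (at y) \<and> d > 0"
      using *[OF y(1)] by (intro exI[of _ "y * sinh y + 2 - 2 * cosh y"]) auto
  qed (intro continuous_intros)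
  thus ?thesis by simp
qed

definition xcoth :: "real \<Rightarrow> real" where
  "xcoth x = x * cosh x / sinh x"

text \<open>The derivative of \<open>xcoth\<close> divided by \<open>2 * x\<close>, that is, its
  derivative with respect to x^2.\<close>

definition xcoth_slope :: "real \<Rightarrow> real" where
  "xcoth_slope x = (sinh x * cosh x - x) / (2 * x * sinh x ^ 2)"

lemma xcoth_has_derivative:
  "(xcoth has_real_derivative 2 * x * xcoth_slope x) (at x)" if "x > 0"
proof -
  have c: "cosh x * cosh x = 1 + sinh x * sinh x" using cosh_square_eq[of x] by (simp add: power2_eq_square)
  have e: "((x * sinh x + cosh x) * sinh x - x * cosh x * cosh x) / (sinh x * sinh x)
      = 2 * x * xcoth_slope x"
    unfolding xcoth_slope_def mult.assoc c using that by (simp add: divide_simps power2_eq_square) (simp add: algebra_simps)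
  show ?thesis
    unfolding xcoth_def[abs_def]
    by ((rule DERIV_cong), (rule DERIV_divide hyp_deriv_rules)+)
       (use e that in \<open>simp_all add: algebra_simps\<close>)
qed

lemma xcoth_slope_pos: "xcoth_slope x > 0" if "x > 0"
  using sinh_cosh_gt[OF that] that by (simp add: xcoth_slope_def)

lemma xcoth_slope_less_third: "xcoth_slope x < 1 / 3" if "x > 0"
proof -
  have "3 * sinh (2 * x) < 2 * x * cosh (2 * x) + 4 * x"
    using sinh_less_third[of "2 * x"] that by simp
  hence "6 * (sinh x * cosh x) < 2 * x * (1 + 2 * sinh x ^ 2) + 4 * x"
    by (simp add: sinh_double cosh_double cosh_square_eq add.commute)
  thus ?thesis using that by (simp add: xcoth_slope_def divide_simps algebra_simps power2_eq_square)
qed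

lemma xcoth_slope_strict_antimono: "xcoth_slope y < xcoth_slope x" if "0 < x" "x < y"
proof (rule DERIV_neg_imp_decreasing[OF that(2)])
  fix z assume "x \<le> z" "z \<le> y"
  hence z: "z > 0" using that by simp
  define s c where "s = sinh z" and "c = cosh z"
  have sc: "s > 0" "c > 0" "c * c = 1 + s * s"
    using z cosh_square_eq[of z] by (auto simp: s_def c_def power2_eq_square)
  \<comment> \<open>\<open>N\<close> is the numerator from the quotient rule. With
    \<open>c * c = 1 + s * s\<close> it factors as \<open>2 * s\<close> times a term whose sign is
    given by \<open>two_sq_less_tanh_sinh\<close> multiplied by \<open>cosh z\<close>.\<close>
  define N where "N = (c * c + s * s - 1) * (2 * z * s\<^sup>2) - (s * c - z) * (2 * s\<^sup>2 + 4 * z * s * c)"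
  define d where "d = N / (2 * z * s\<^sup>2)\<^sup>2"
  have "(xcoth_slope has_real_derivative d) (at z)"
    unfolding xcoth_slope_def[abs_def]
    by ((rule DERIV_cong), (rule DERIV_divide hyp_deriv_rules)+)
       (use z sc in \<open>simp_all add: d_def N_def s_def[symmetric] c_def[symmetric] power2_eq_square algebra_simps\<close>)
  moreover have "d < 0"
  proof -
    have "2 * z\<^sup>2 * c < (z * tanh z + s\<^sup>2) * c"
      using two_sq_less_tanh_sinh[OF z] sc by (simp add: s_def)
    also have "\<dots> = z * s + s\<^sup>2 * c"
      using sc by (simp add: tanh_def s_def c_def algebra_simps)
    finally have "2 * s * (2 * z\<^sup>2 * c - z * s - s\<^sup>2 * c) < 0"
      using sc by (simp add: mult_pos_neg)
    moreover have "N = 2 * s * (2 * z\<^sup>2 * c - z * s - s\<^sup>2 * c)"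
      unfolding N_def using sc(3) by algebra
    ultimately show ?thesis
      using z sc by (simp add: d_def divide_neg_pos)
  qed
  ultimately show "\<exists>d. (xcoth_slope has_real_derivative d) (at z) \<and> d < 0" by blast
qed

lemma xcoth_gt_1: "xcoth x > 1" if "x > 0"
  using sinh_less_mult_cosh[OF that] that by (simp add: xcoth_def)

lemma xcoth_strict_mono: "xcoth x < xcoth y" if "0 < x" "x < y"
proof (rule DERIV_pos_imp_increasing[OF that(2)])
  fix z assume "x \<le> z" "z \<le> y"
  hence z: "z > 0" using that by simp
  show "\<exists>d. (xcoth has_real_derivative d) (at z) \<and> d > 0"
    using xcoth_has_derivative[OF z] xcoth_slope_pos[OF z] z by (intro exI[of _ "2 * z * xcoth_slope z"]) auto
qed

section \<open>Level sets of \<open>A * xcoth x - B * x^2\<close>\<close>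

lemma xcoth_quadratic_has_derivative:
  "((\<lambda>x. A * xcoth x - B * x\<^sup>2) has_real_derivative 2 * x * (A * xcoth_slope x - B)) (at x)"
  if "x > 0"
  using that by (auto intro!: derivative_eq_intros xcoth_has_derivative simp: algebra_simps)

text \<open>Between two points at the same level the derivative vanishes somewhere, and its factor
  \<open>2 * z\<close> is nonzero.\<close>

lemma xcoth_quadratic_critical:
  assumes "0 < x" "x < y" "A * xcoth x - B * x\<^sup>2 = p" "A * xcoth y - B * y\<^sup>2 = p"
  obtains z where "x < z" "z < y" "A * xcoth_slope z = B"
proof -
  have "\<exists>z. x < z \<and> z < y \<and> (\<lambda>x. A * xcoth x - B * x\<^sup>2) y - (\<lambda>x. A * xcoth x - B * x\<^sup>2) x
      = (y - x) * (2 * z * (A * xcoth_slope z - B))"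
    by (rule MVT2[OF assms(2)]) (use assms(1) xcoth_quadratic_has_derivative in auto)
  then obtain z where "x < z" "z < y" "(y - x) * (2 * z * (A * xcoth_slope z - B)) = 0"
    using assms(3,4) by auto
  thus ?thesis using that[of z] assms(1) by auto
qed

text \<open>Three points at one level enclose two critical points, at both of which
  \<open>xcoth_slope\<close> would equal \<open>B / A\<close>, against its strict decrease.\<close>

lemma xcoth_quadratic_at_most_two:
  assumes "A > 0" "0 < x" "x < y" "y < z"
    and "A * xcoth x - B * x\<^sup>2 = p" "A * xcoth y - B * y\<^sup>2 = p" "A * xcoth z - B * z\<^sup>2 = p"
  shows False
proof -
  obtain u where u: "x < u" "u < y" "A * xcoth_slope u = B"
    using xcoth_quadratic_critical assms by metis
  obtain v where v: "y < v" "v < z" "A * xcoth_slope v = B"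
    using xcoth_quadratic_critical assms by (metis less_trans)
  have "xcoth_slope v < xcoth_slope u" using u v assms by (intro xcoth_slope_strict_antimono) auto
  thus False using u v assms(1) by auto
qed

text \<open>At the critical point \<open>z\<close> between \<open>x\<close> and \<open>y\<close>,
  \<open>B\<close> is \<open>A\<close> times a slope in (0, 1/3). To the left of \<open>z\<close>
  the function increases, starting from its limit \<open>A\<close> at 0, so \<open>A\<close> cannot
  exceed the level \<open>p\<close>.\<close>

lemma xcoth_quadratic_two_solutions:
  assumes A: "A > 0" and xy: "0 < x" "x < y"
    and "A * xcoth x - B * x\<^sup>2 = p" "A * xcoth y - B * y\<^sup>2 = p"
  shows "0 < B" and "B < A / 3" and "A \<le> p"
proof -
  obtain z where z: "x < z" "z < y" "A * xcoth_slope z = B"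
    using xcoth_quadratic_critical assms by metis
  show "0 < B" using z xcoth_slope_pos[of z] A xy by auto
  show "B < A / 3" using z xcoth_slope_less_third[of z] A xy by auto
  \<comment> \<open>Up to \<open>x\<close> every slope exceeds the one at \<open>z\<close>, so the
    value at \<open>w\<close> is below \<open>p\<close>; \<open>xcoth w > 1\<close> then bounds
    \<open>A\<close>.\<close>
  have le: "A \<le> p + B * w\<^sup>2" if w: "0 < w" "w < x" for w
  proof -
    have "(\<lambda>x. A * xcoth x - B * x\<^sup>2) w < (\<lambda>x. A * xcoth x - B * x\<^sup>2) x"
    proof (rule DERIV_pos_imp_increasing[OF w(2)])
      fix v assume v: "w \<le> v" "v \<le> x"
      have "A * xcoth_slope v > B"
        using xcoth_slope_strict_antimono[of v z] z v w A by auto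
      thus "\<exists>d. ((\<lambda>x. A * xcoth x - B * x\<^sup>2) has_real_derivative d) (at v) \<and> d > 0"
        using xcoth_quadratic_has_derivative[of v A B] v w
        by (intro exI[of _ "2 * v * (A * xcoth_slope v - B)"]) auto
    qed
    moreover have "A \<le> A * xcoth w" using xcoth_gt_1[OF w(1)] A by simp
    ultimately show ?thesis using assms(4) by simp
  qed
  \<comment> \<open>Letting \<open>w\<close> tend to 0 from the right removes the quadratic
    term.\<close>
  have "((\<lambda>w. p + B * w\<^sup>2) \<longlongrightarrow> p + B * 0\<^sup>2) (at_right 0)"
    by (intro tendsto_intros)
  moreover have "eventually (\<lambda>w. A \<le> p + B * w\<^sup>2) (at_right 0)"
    using le xy(1) by (auto simp: eventually_at_right intro: exI[of _ x])
  ultimately show "A \<le> p"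
    using tendsto_lowerbound[of "\<lambda>w. p + B * w\<^sup>2" "p + B * 0\<^sup>2"] by fastforce
qed

section \<open>Rapidly decreasing Fourier series\<close>

text \<open>The symmetry that characterizes coefficients of real-valued functions.\<close>

definition hermitian :: "(int \<Rightarrow> complex) \<Rightarrow> bool" where
  "hermitian a \<longleftrightarrow> (\<forall>k. a (- k) = cnj (a k))"

text \<open>A class that contains the coefficients of analytic functions and is stable under every
  multiplier occurring in \<open>Lop\<close>, so that compositions need no count of
  derivatives.\<close>

definition rapid :: "(int \<Rightarrow> complex) \<Rightarrow> bool" where
  "rapid a \<longleftrightarrow> (\<forall>n. (\<lambda>k. cmod (a k) * \<bar>real_of_int k\<bar> ^ n) summable_on UNIV)"

definition csynth :: "(int \<Rightarrow> complex) \<Rightarrow> real \<Rightarrow> complex" where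
  "csynth a x = (\<Sum>\<^sub>\<infinity>k. a k * cis (of_int k * x))"

definition synth :: "(int \<Rightarrow> complex) \<Rightarrow> real \<Rightarrow> real" where
  "synth a x = Re (csynth a x)"

lemma rapid_imp_summable: "(\<lambda>k. cmod (a k)) summable_on UNIV" if "rapid a"
  using that[unfolded rapid_def, rule_format, of 0] by simp

text \<open>The exponent \<open>p\<close> is the order of a multiplier: 0 for bounded ones such as
  \<open>isym\<close> and \<open>psym\<close>, 1 for \<open>dsym\<close> and
  \<open>gsym\<close>.\<close>

lemma rapid_comparison:
  assumes "rapid a" and "\<And>k. cmod (b k) \<le> C * (cmod (a k) * \<bar>real_of_int k\<bar> ^ p)"
  shows "rapid b"
  unfolding rapid_def
proof
  fix n
  have "(\<lambda>k. C * (cmod (a k) * \<bar>real_of_int k\<bar> ^ (p + n))) summable_on UNIV"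
    using assms(1) by (intro summable_on_cmult_right) (simp add: rapid_def)
  thus "(\<lambda>k. cmod (b k) * \<bar>real_of_int k\<bar> ^ n) summable_on UNIV"
  proof (rule summable_on_comparison_test)
    fix k :: int
    have "cmod (b k) * \<bar>real_of_int k\<bar> ^ n \<le> C * (cmod (a k) * \<bar>real_of_int k\<bar> ^ p) * \<bar>real_of_int k\<bar> ^ n"
      by (intro mult_right_mono assms(2)) auto
    thus "cmod (b k) * \<bar>real_of_int k\<bar> ^ n \<le> C * (cmod (a k) * \<bar>real_of_int k\<bar> ^ (p + n))"
      by (simp add: power_add mult_ac)
  qed auto
qed

lemma rapid_add: "rapid (a + b)" if "rapid a" "rapid b"
  unfolding rapid_def
proof
  fix n
  have "(\<lambda>k. cmod (a k) * \<bar>real_of_int k\<bar> ^ n + cmod (b k) * \<bar>real_of_int k\<bar> ^ n) summable_on UNIV"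
    using that by (intro summable_on_add) (auto simp: rapid_def)
  thus "(\<lambda>k. cmod ((a + b) k) * \<bar>real_of_int k\<bar> ^ n) summable_on UNIV"
    by (rule summable_on_comparison_test)
       (auto simp: norm_triangle_ineq distrib_right[symmetric] intro!: mult_right_mono)
qed

lemma rapid_scaleR: "rapid (r *\<^sub>R a)" if "rapid a"
  by (rule rapid_comparison[OF that, of _ "\<bar>r\<bar>" 0]) (simp add: scaleR_fun_def)

lemma hermitian_add: "hermitian (a + b)" if "hermitian a" "hermitian b"
  using that by (simp add: hermitian_def)

lemma hermitian_scaleR: "hermitian (r *\<^sub>R a)" if "hermitian a"
  using that by (simp add: hermitian_def scaleR_fun_def)

lemma diff_eq_add_scaleR: "a - b = a + (- 1) *\<^sub>R b" for a b :: "int \<Rightarrow> complex"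
  by (simp add: fun_eq_iff scaleR_fun_def)

lemma rapid_diff: "rapid (a - b)" if "rapid a" "rapid b"
  unfolding diff_eq_add_scaleR by (intro rapid_add rapid_scaleR that)

lemma hermitian_diff: "hermitian (a - b)" if "hermitian a" "hermitian b"
  unfolding diff_eq_add_scaleR by (intro hermitian_add hermitian_scaleR that)

lemma csynth_summable: "(\<lambda>k. a k * cis (of_int k * x)) summable_on UNIV" if "rapid a"
  by (rule abs_summable_summable) (use rapid_imp_summable[OF that] in \<open>simp add: norm_mult\<close>)

text \<open>Substituting \<open>- k\<close> for \<open>k\<close> turns the conjugate of the series
  into the series itself.\<close>

lemma of_real_synth: "complex_of_real (synth a x) = csynth a x" if "hermitian a"
proof -
  have "cnj (csynth a x) = (\<Sum>\<^sub>\<infinity>k. a (- k) * cis (of_int (- k) * x))"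
    using that by (simp add: csynth_def hermitian_def cis_cnj flip: infsum_cnj)
  also have "\<dots> = csynth a x"
    unfolding csynth_def by (rule infsum_reindex_bij_betw[OF bij_uminus])
  finally show ?thesis
    by (metis synth_def Reals_cnj_iff of_real_Re)
qed

lemma synth_add: "synth (a + b) = synth a + synth b" if "rapid a" "rapid b"
proof
  fix x
  have "csynth (a + b) x = csynth a x + csynth b x"
    unfolding csynth_def
    by (subst infsum_add[symmetric]) (use that in \<open>auto intro!: csynth_summable simp: distrib_right\<close>)
  thus "synth (a + b) x = (synth a + synth b) x" by (simp add: synth_def)
qed

lemma synth_scaleR: "synth (r *\<^sub>R a) = r *\<^sub>R synth a"
proof
  fix x
  have "csynth (r *\<^sub>R a) x = complex_of_real r * csynth a x"
    unfolding csynth_def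
    by (subst infsum_cmult_right'[symmetric]) (simp add: scaleR_fun_def scaleR_conv_of_real mult.assoc)
  thus "synth (r *\<^sub>R a) x = (r *\<^sub>R synth a) x" by (simp add: synth_def scaleR_fun_def)
qed

lemma synth_diff: "synth (a - b) = synth a - synth b" if "rapid a" "rapid b"
  using that by (simp only: diff_eq_add_scaleR synth_add rapid_scaleR synth_scaleR)
     (simp add: scaleR_fun_def fun_eq_iff)

lemma synth_finite_support:
  assumes "finite S" "\<And>k. k \<notin> S \<Longrightarrow> a k = 0"
  shows "synth a x = (\<Sum>k\<in>S. Re (a k * cis (of_int k * x)))"
proof -
  have "((\<lambda>k. a k * cis (of_int k * x)) has_sum (\<Sum>k\<in>S. a k * cis (of_int k * x))) UNIV"
    by (rule has_sum_finite_neutralI) (use assms in auto)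
  thus ?thesis by (simp add: synth_def csynth_def infsumI)
qed

lemma rapid_finite_support:
  assumes "finite S" "\<And>k. k \<notin> S \<Longrightarrow> a k = 0"
  shows "rapid a"
  unfolding rapid_def
proof
  fix n
  show "(\<lambda>k. cmod (a k) * \<bar>real_of_int k\<bar> ^ n) summable_on UNIV"
    by (rule summable_on_cong_neutral[THEN iffD1, OF _ _ _ summable_on_finite[OF assms(1)]])
       (use assms(2) in auto)
qed

section \<open>Uniform convergence, termwise integration and orthogonality\<close>

lemma uniform_limit_csynth:
  assumes "rapid a"
  shows "uniform_limit X (\<lambda>F x. \<Sum>k\<in>F. a k * cis (of_int k * x) * cis (m * x))
           (\<lambda>x. csynth a x * cis (m * x)) (finite_subsets_at_top UNIV)"
proof -
  have "uniform_limit X (\<lambda>F x. \<Sum>k\<in>F. a k * cis (of_int k * x) * cis (m * x))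
           (\<lambda>x. \<Sum>\<^sub>\<infinity>k. a k * cis (of_int k * x) * cis (m * x)) (finite_subsets_at_top UNIV)"
    by (rule Weierstrass_m_test_general[OF _ rapid_imp_summable[OF assms]]) (simp add: norm_mult)
  thus ?thesis by (simp add: csynth_def infsum_cmult_left')
qed

lemma continuous_on_csynth: "continuous_on X (csynth a)" if "rapid a"
proof -
  have "continuous_on X (\<lambda>x. csynth a x * cis (0 * x))"
    by (rule uniform_limit_theorem[OF _ uniform_limit_csynth[OF that]])
       (auto intro!: continuous_intros always_eventually)
  thus ?thesis by simp
qed

text \<open>Uniform convergence allows termwise integration. The factor \<open>cis (m * x)\<close>
  makes one statement serve twice: \<open>m = 0\<close> yields primitives, a negated integer yields
  Fourier coefficients.\<close>

lemma has_sum_integral_csynth: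
  assumes "rapid a"
  shows "((\<lambda>k. a k * integral {p..q} (\<lambda>x. cis ((of_int k + m) * x))) has_sum
            integral {p..q} (\<lambda>x. csynth a x * cis (m * x))) UNIV"
proof -
  obtain I J where I: "\<And>F. ((\<lambda>x. \<Sum>k\<in>F. a k * cis (of_int k * x) * cis (m * x)) has_integral I F) {p..q}"
    and J: "((\<lambda>x. csynth a x * cis (m * x)) has_integral J) {p..q}"
    and lim: "(I \<longlongrightarrow> J) (finite_subsets_at_top UNIV)"
    by (rule uniform_limit_integral[OF uniform_limit_csynth[OF assms]]) (auto intro!: continuous_intros)
  have "((\<lambda>x. \<Sum>k\<in>F. a k * cis (of_int k * x) * cis (m * x)) has_integral
      (\<Sum>k\<in>F. a k * integral {p..q} (\<lambda>x. cis ((of_int k + m) * x)))) {p..q}" if "finite F" for F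
  proof (rule has_integral_sum[OF that])
    fix k :: int
    have "((\<lambda>x. cis ((of_int k + m) * x)) has_integral integral {p..q} (\<lambda>x. cis ((of_int k + m) * x))) {p..q}"
      by (intro integrable_integral integrable_continuous_real continuous_intros)
    from has_integral_mult_right[OF this, of "a k"]
    show "((\<lambda>x. a k * cis (of_int k * x) * cis (m * x)) has_integral
        a k * integral {p..q} (\<lambda>x. cis ((of_int k + m) * x))) {p..q}"
      by (simp add: mult.assoc cis_mult distrib_right)
  qed
  hence "I F = (\<Sum>k\<in>F. a k * integral {p..q} (\<lambda>x. cis ((of_int k + m) * x)))" if "finite F" for F
    using I that has_integral_unique by blast
  hence "((\<lambda>F. \<Sum>k\<in>F. a k * integral {p..q} (\<lambda>x. cis ((of_int k + m) * x))) \<longlongrightarrow> J) (finite_subsets_at_top UNIV)"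
    using lim by (elim Lim_transform_eventually) (auto intro: eventually_finite_subsets_at_top_weakI)
  thus ?thesis using J by (simp add: has_sum_def integral_unique)
qed

lemma integral_cis:
  assumes "w \<noteq> 0" "p \<le> q"
  shows "integral {p..q} (\<lambda>x. cis (w * x)) = (cis (w * q) - cis (w * p)) / (\<i> * of_real w)"
proof -
  have "((\<lambda>x. cis (w * x)) has_integral
       cis (w * q) / (\<i> * of_real w) - cis (w * p) / (\<i> * of_real w)) {p..q}"
  proof (rule fundamental_theorem_of_calculus[OF assms(2)])
    fix x
    have "((\<lambda>x. cis (w * x)) has_vector_derivative w *\<^sub>R (\<i> * cis (w * x))) (at x within {p..q})"
      unfolding has_vector_derivative_def
      by (rule derivative_eq_intros refl)+ (simp add: fun_eq_iff mult.commute)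
    from has_vector_derivative_mult_left[OF this, of "1 / (\<i> * of_real w)"]
    show "((\<lambda>x. cis (w * x) / (\<i> * of_real w)) has_vector_derivative cis (w * x)) (at x within {p..q})"
      using assms(1) by (simp add: scaleR_conv_of_real)
  qed
  thus ?thesis by (simp add: integral_unique diff_divide_distrib)
qed

lemma integral_cis_period:
  "integral {0..2 * pi} (\<lambda>x. cis (of_int j * x)) = (if j = 0 then 2 * pi else 0)"
proof (cases "j = 0")
  case False
  have "cis (of_int j * (2 * pi)) = 1"
    using cis_multiple_2pi[of "of_int j"] by (simp add: mult_ac)
  thus ?thesis using False integral_cis[of "of_int j" 0 "2 * pi"] by simp
qed (auto simp: scaleR_conv_of_real)

text \<open>By orthogonality only the term \<open>k = m\<close> survives integration. Hence the
  function determines its coefficients, which gives \<open>synth_eq_0_iff\<close>.\<close>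

lemma fourier_coeff_synth: "fourier_coeff (synth a) m = a m" if "hermitian a" "rapid a"
proof -
  have "((\<lambda>k. a k * integral {0..2 * pi} (\<lambda>x. cis ((of_int k + (- of_int m)) * x))) has_sum
      integral {0..2 * pi} (\<lambda>x. csynth a x * cis (- of_int m * x))) UNIV"
    by (rule has_sum_integral_csynth[OF that(2)])
  moreover have "((\<lambda>k. a k * integral {0..2 * pi} (\<lambda>x. cis ((of_int k + (- of_int m)) * x))) has_sum
      a m * (2 * pi)) UNIV"
  proof (rule has_sum_finite_neutralI[of "{m}"])
    fix k assume "k \<in> UNIV - {m}"
    thus "a k * integral {0..2 * pi} (\<lambda>x. cis ((of_int k + (- of_int m)) * x)) = 0"
      using integral_cis_period[of "k - m"] by simp
  qed (use integral_cis_period[of 0] in simp_all)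
  ultimately have "integral {0..2 * pi} (\<lambda>x. csynth a x * cis (- of_int m * x)) = a m * (2 * pi)"
    by (rule has_sum_unique)
  thus ?thesis
    by (simp add: fourier_coeff_def of_real_synth that)
qed

section \<open>Derivative, mean, projection and primitive in terms of coefficients\<close>

definition dsym :: "(int \<Rightarrow> complex) \<Rightarrow> int \<Rightarrow> complex" where
  "dsym a k = \<i> * of_int k * a k"

text \<open>At \<open>k = 0\<close> the division by zero yields 0, so the primitive selected is the
  one of zero mean.\<close>

definition isym :: "(int \<Rightarrow> complex) \<Rightarrow> int \<Rightarrow> complex" where
  "isym a k = a k / (\<i> * of_int k)"

lemma rapid_dsym: "rapid (dsym a)" if "rapid a"
  by (rule rapid_comparison[OF that, of _ 1 1]) (simp add: dsym_def norm_mult)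

lemma rapid_isym: "rapid (isym a)" if "rapid a"
proof (rule rapid_comparison[OF that, of _ 1 0])
  fix k
  have "cmod (a k) \<le> cmod (a k) * \<bar>real_of_int k\<bar>" if "k \<noteq> 0"
    using that mult_left_mono[of 1 "\<bar>real_of_int k\<bar>" "cmod (a k)"] by simp
  thus "cmod (isym a k) \<le> 1 * (cmod (a k) * \<bar>real_of_int k\<bar> ^ 0)"
    by (cases "k = 0") (simp_all add: isym_def norm_divide norm_mult divide_simps)
qed

lemma hermitian_dsym: "hermitian (dsym a)" if "hermitian a"
  using that by (simp add: hermitian_def dsym_def)

lemma hermitian_isym: "hermitian (isym a)" if "hermitian a"
  using that by (simp add: hermitian_def isym_def)

text \<open>The differentiated series is integrated termwise, which recovers \<open>csynth a\<close>
  up to a constant; the fundamental theorem of calculus then gives the derivative.\<close>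

lemma csynth_has_vector_derivative:
  assumes "rapid a"
  shows "(csynth a has_vector_derivative csynth (dsym a) x) (at x)"
proof -
  \<comment> \<open>Integration starts at \<open>x - 1\<close> so that \<open>x\<close> is interior
    to the range of \<open>y\<close> covered by the identity, as a two-sided derivative
    requires.\<close>
  have *: "csynth a y = csynth a (x - 1) + integral {x - 1..y} (csynth (dsym a))" if "x - 1 \<le> y" for y
  proof -
    have "((\<lambda>k. dsym a k * integral {x - 1..y} (\<lambda>t. cis ((of_int k + 0) * t))) has_sum
        integral {x - 1..y} (\<lambda>t. csynth (dsym a) t * cis (0 * t))) UNIV"
      by (rule has_sum_integral_csynth[OF rapid_dsym[OF assms]])
    moreover have "dsym a k * integral {x - 1..y} (\<lambda>t. cis ((of_int k + 0) * t))
        = a k * cis (of_int k * y) - a k * cis (of_int k * (x - 1))" for k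
    proof (cases "k = 0")
      case False
      thus ?thesis using that integral_cis[of "of_int k" "x - 1" y]
        by (simp add: dsym_def right_diff_distrib diff_divide_distrib)
    qed (simp add: dsym_def)
    ultimately have "((\<lambda>k. a k * cis (of_int k * y) - a k * cis (of_int k * (x - 1))) has_sum
        integral {x - 1..y} (csynth (dsym a))) UNIV"
      by simp
    moreover have "((\<lambda>k. a k * cis (of_int k * y) - a k * cis (of_int k * (x - 1))) has_sum
        (csynth a y - csynth a (x - 1))) UNIV"
      unfolding csynth_def diff_conv_add_uminus[of "a _ * _"] diff_conv_add_uminus[of "infsum _ _"]
      by (intro has_sum_add has_sum_uminusI has_sum_infsum csynth_summable assms)
    ultimately have "csynth a y - csynth a (x - 1) = integral {x - 1..y} (csynth (dsym a))"
      by (intro has_sum_unique)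
    thus ?thesis by (simp add: algebra_simps)
  qed
  have "((\<lambda>y. integral {x - 1..y} (csynth (dsym a))) has_vector_derivative csynth (dsym a) x)
      (at x within {x - 1..x + 1})"
    by (intro integral_has_vector_derivative continuous_on_csynth rapid_dsym assms) auto
  hence "((\<lambda>y. integral {x - 1..y} (csynth (dsym a))) has_vector_derivative csynth (dsym a) x) (at x)"
    by (simp add: at_within_Icc_at)
  hence "((\<lambda>y. csynth a (x - 1) + integral {x - 1..y} (csynth (dsym a))) has_vector_derivative
      0 + csynth (dsym a) x) (at x)"
    by (intro has_vector_derivative_add has_vector_derivative_const)
  hence "(csynth a has_vector_derivative 0 + csynth (dsym a) x) (at x)"
    by (rule has_vector_derivative_transform_within_open[where S = "{x - 1<..}"])
       (simp_all, rule *[symmetric], simp)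
  thus ?thesis by simp
qed

lemma synth_has_derivative: "(synth a has_real_derivative synth (dsym a) x) (at x)" if "rapid a"
  using bounded_linear.has_vector_derivative[OF bounded_linear_Re csynth_has_vector_derivative[OF that]]
  by (simp add: has_real_derivative_iff_has_vector_derivative synth_def[abs_def])

lemma deriv_synth: "deriv (synth a) = synth (dsym a)" if "rapid a"
  using synth_has_derivative[OF that] by (auto intro!: DERIV_imp_deriv)

lemma periodic_synth: "periodic (synth a)"
proof -
  have "cis (of_int k * (x + 2 * pi)) = cis (of_int k * x)" for k x
    using cis_multiple_2pi[of "of_int k"] by (simp add: distrib_left mult_ac flip: cis_mult)
  thus ?thesis by (simp add: periodic_def synth_def csynth_def)
qed

lemma of_real_mean: "complex_of_real (mean u) = fourier_coeff u 0" if "continuous_on {0..2 * pi} u"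
proof -
  have "integral {0..2 * pi} (complex_of_real \<circ> u) = complex_of_real (integral {0..2 * pi} u)"
    by (intro integral_linear integrable_continuous_real bounded_linear_of_real that)
  thus ?thesis by (simp add: mean_def fourier_coeff_def comp_def)
qed

lemma continuous_on_synth: "continuous_on X (synth a)" if "rapid a"
  unfolding synth_def[abs_def] by (intro continuous_intros continuous_on_csynth that)

lemma of_real_mean_synth: "complex_of_real (mean (synth a)) = a 0" if "hermitian a" "rapid a"
  by (simp add: of_real_mean continuous_on_synth fourier_coeff_synth that)

lemma synth_eq_0_iff: "synth a = 0 \<longleftrightarrow> a = 0" if "hermitian a" "rapid a"
proof
  assume "synth a = 0"
  hence "synth a = synth 0" by (simp add: fun_eq_iff synth_def csynth_def)
  moreover have "hermitian 0" "rapid 0" by (simp_all add: hermitian_def rapid_def)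
  ultimately show "a = 0" using that fourier_coeff_synth by (metis ext)
qed (simp add: fun_eq_iff synth_def csynth_def)

definition psym :: "(int \<Rightarrow> complex) \<Rightarrow> int \<Rightarrow> complex" where
  "psym a k = (if k = 0 then 0 else a k)"

lemma rapid_psym: "rapid (psym a)" if "rapid a"
  by (rule rapid_comparison[OF that, of _ 1 0]) (simp add: psym_def)

lemma hermitian_psym: "hermitian (psym a)" if "hermitian a"
  using that by (simp add: hermitian_def psym_def)

lemma proj0_synth: "proj0 (synth a) = synth (psym a)" if "hermitian a" "rapid a"
proof
  fix x
  \<comment> \<open>The difference is supported at 0, so it synthesizes the constant to be
    subtracted, the mean.\<close>
  have "synth (a - psym a) x = Re (a 0)"
    using synth_finite_support[of "{0}" "a - psym a" x] by (simp add: psym_def)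
  moreover have "synth (a - psym a) = synth a - synth (psym a)"
    by (intro synth_diff rapid_psym that)
  moreover have "Re (a 0) = mean (synth a)"
    by (simp flip: of_real_mean_synth[OF that])
  ultimately show "proj0 (synth a) x = synth (psym a) x"
    by (simp add: proj0_def)
qed

lemma fourier_multiplier_synth:
  "fourier_multiplier m (synth a) = synth (\<lambda>k. complex_of_real (m (of_int k)) * a k)"
  if "hermitian a" "rapid a"
  unfolding fourier_multiplier_def fourier_coeff_synth[OF that] synth_def csynth_def ..

text \<open>\<open>dx_inv\<close> is an \<open>inv_into\<close> on this set, so evaluating it takes
  uniqueness: two primitives differ by a constant, and equal means make the constant 0.\<close>

lemma inj_on_deriv_mean_zero:
  "inj_on deriv {v. periodic v \<and> (\<forall>x. v differentiable (at x)) \<and> mean v = 0}"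
proof (rule inj_onI; clarify)
  fix v w :: "real \<Rightarrow> real"
  assume v: "\<forall>x. v differentiable (at x)" and w: "\<forall>x. w differentiable (at x)"
    and m: "mean v = 0" "mean w = 0" and eq: "deriv v = deriv w"
  have "((\<lambda>x. v x - w x) has_real_derivative deriv v x - deriv w x) (at x)" for x
    using v w by (intro DERIV_diff) (simp_all add: DERIV_deriv_iff_real_differentiable)
  hence "\<forall>x. ((\<lambda>x. v x - w x) has_real_derivative 0) (at x)" using eq by simp
  hence c: "v x - w x = v 0 - w 0" for x by (rule DERIV_isconst_all)
  have "continuous_on {0..2 * pi} f" if "\<forall>x. f differentiable (at x)" for f :: "real \<Rightarrow> real"
    using that by (meson continuous_at_imp_continuous_on differentiable_imp_continuous_within)
  hence "integral {0..2 * pi} (\<lambda>x. v x - w x) = integral {0..2 * pi} v - integral {0..2 * pi} w"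
    using v w by (intro integral_diff integrable_continuous_real) auto
  also have "\<dots> = 0" using m by (simp add: mean_def)
  also have "(\<lambda>x. v x - w x) = (\<lambda>x. v 0 - w 0)" using c by (rule ext)
  finally have "v 0 - w 0 = 0" by simp
  hence "v x = w x" for x using c[of x] by linarith
  thus "v = w" by (rule ext)
qed

lemma dx_inv_synth: "dx_inv (synth a) = synth (isym a)" if "hermitian a" "rapid a" "a 0 = 0"
  unfolding dx_inv_def
proof (rule inv_into_f_eq[OF inj_on_deriv_mean_zero])
  have r: "rapid (isym a)" using that by (intro rapid_isym)
  have "dsym (isym a) = a" using that by (auto simp: dsym_def isym_def)
  thus "deriv (synth (isym a)) = synth a" by (simp add: deriv_synth r)
  have "mean (synth (isym a)) = 0"
    using of_real_mean_synth[OF hermitian_isym[OF that(1)] r] by (simp add: isym_def)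
  moreover have "synth (isym a) differentiable (at x)" for x
    using synth_has_derivative[OF r] by (meson real_differentiable_def)
  ultimately show "synth (isym a) \<in> {v. periodic v \<and> (\<forall>x. v differentiable (at x)) \<and> mean v = 0}"
    by (simp add: periodic_synth)
qed

section \<open>Exponentially weighted spaces and rapid decrease\<close>

lemma power_le_fact_mult_exp: "x ^ n \<le> fact n * exp x" if "x \<ge> 0" for x :: real
proof -
  have "(\<Sum>m\<in>{n}. x ^ m /\<^sub>R fact m) \<le> (\<Sum>m. x ^ m /\<^sub>R fact m)"
    by (rule sum_le_suminf[OF sums_summable[OF exp_converges]]) (use that in simp_all)
  also have "\<dots> = exp x" by (rule sums_unique[OF exp_converges, symmetric])
  finally have "x ^ n / fact n \<le> exp x" by (simp add: divide_inverse mult.commute)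
  thus ?thesis by (simp add: pos_divide_le_eq mult.commute)
qed

lemma summable_on_int_geometric: "(\<lambda>k::int. r ^ nat \<bar>k\<bar>) summable_on UNIV" if "0 \<le> r" "r < 1" for r :: real
proof -
  have s: "(\<lambda>n. r ^ n) summable_on UNIV"
    by (rule norm_summable_imp_summable_on) (use that in \<open>simp add: norm_power summable_geometric\<close>)
  have "(\<lambda>k::int. r ^ nat \<bar>k\<bar>) summable_on range int"
    by (subst summable_on_reindex) (auto simp: comp_def s)
  moreover have "(\<lambda>k::int. r ^ nat \<bar>k\<bar>) summable_on range (\<lambda>n. - int n)"
    by (subst summable_on_reindex) (auto simp: comp_def s inj_def)
  ultimately have "(\<lambda>k::int. r ^ nat \<bar>k\<bar>) summable_on (range int \<union> range (\<lambda>n. - int n))"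
    by (rule summable_on_union)
  moreover have "range int \<union> range (\<lambda>n. - int n) = UNIV"
  proof -
    have "k \<in> range int \<union> range (\<lambda>n. - int n)" for k by (cases k rule: int_cases2) auto
    thus ?thesis by auto
  qed
  ultimately show ?thesis by simp
qed

text \<open>One half of the exponential absorbs the power of \<open>k\<close>; the other half is a
  geometric sequence in \<open>nat \<bar>k\<bar>\<close>.\<close>

lemma rapid_exp_decay:
  assumes "\<sigma> > 0" "\<And>k. cmod (a k) \<le> C * exp (- \<sigma> * \<bar>real_of_int k\<bar>)"
  shows "rapid a"
  unfolding rapid_def
proof
  fix n
  define \<tau> where "\<tau> = \<sigma> / 2"
  have \<tau>: "\<tau> > 0" "\<sigma> = \<tau> + \<tau>" using assms(1) by (simp_all add: \<tau>_def)
  have C: "C \<ge> 0" using order_trans[OF norm_ge_zero assms(2)[of 0]] by simp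
  have "(\<lambda>k::int. C * (fact n / \<tau> ^ n) * exp (- \<tau>) ^ nat \<bar>k\<bar>) summable_on UNIV"
    using \<tau> by (intro summable_on_cmult_right summable_on_int_geometric) auto
  thus "(\<lambda>k. cmod (a k) * \<bar>real_of_int k\<bar> ^ n) summable_on UNIV"
  proof (rule summable_on_comparison_test)
    fix k :: int
    define y where "y = \<bar>real_of_int k\<bar>"
    have "(\<tau> * y) ^ n \<le> fact n * exp (\<tau> * y)"
      using \<tau> by (intro power_le_fact_mult_exp) (auto simp: y_def)
    hence y: "y ^ n \<le> fact n * exp (\<tau> * y) / \<tau> ^ n"
      using \<tau> by (simp add: power_mult_distrib pos_le_divide_eq mult.commute)
    have e: "exp (- \<sigma> * y) * exp (\<tau> * y) = exp (- \<tau>) ^ nat \<bar>k\<bar>"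
      unfolding \<tau>(2) by (simp add: y_def exp_of_nat_mult[symmetric] exp_add[symmetric] algebra_simps)
    have "cmod (a k) * y ^ n \<le> (C * exp (- \<sigma> * y)) * (fact n * exp (\<tau> * y) / \<tau> ^ n)"
      by (rule mult_mono) (use assms(2)[of k] y C in \<open>auto simp: y_def\<close>)
    also have "\<dots> = C * (fact n / \<tau> ^ n) * (exp (- \<sigma> * y) * exp (\<tau> * y))" by simp
    also note e
    finally show "cmod (a k) * \<bar>real_of_int k\<bar> ^ n \<le> C * (fact n / \<tau> ^ n) * exp (- \<tau>) ^ nat \<bar>k\<bar>"
      by (simp only: y_def)
  qed auto
qed

text \<open>A single term of the weighted sum is at most the whole sum, and its weight is at least
  the square of \<open>exp (\<sigma> * \<bar>k\<bar>)\<close>. A square root gives exponential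
  decay.\<close>

lemma rapid_fourier_coeff:
  assumes "u \<in> Hspace \<sigma> s" "\<sigma> > 0" "s \<ge> 0"
  shows "rapid (fourier_coeff u)"
proof -
  define w where "w = (\<lambda>k::int. (cmod (fourier_coeff u k))\<^sup>2 * (max 1 \<bar>real_of_int k\<bar>) powr (2 * s)
            * exp (2 * \<sigma> * \<bar>real_of_int k\<bar>))"
  have s: "w summable_on UNIV" using assms by (simp add: Hspace_def w_def)
  show ?thesis
  proof (rule rapid_exp_decay[OF assms(2)])
    fix k :: int
    define E where "E = exp (\<sigma> * \<bar>real_of_int k\<bar>)"
    have "(max 1 \<bar>real_of_int k\<bar>) powr (2 * s) \<ge> 1"
      using assms(3) by (intro ge_one_powr_ge_zero) auto
    hence "(cmod (fourier_coeff u k))\<^sup>2 * 1 * E\<^sup>2 \<le> w k"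
      unfolding w_def E_def
      by (intro mult_mono) (auto simp: power2_eq_square exp_add[symmetric] mult_ac)
    also have "w k \<le> infsum w UNIV"
      using finite_sum_le_infsum[OF s, of "{k}"] by (auto simp: w_def)
    finally have "(cmod (fourier_coeff u k) * E)\<^sup>2 \<le> infsum w UNIV" by (simp add: power_mult_distrib)
    hence "cmod (fourier_coeff u k) * E \<le> sqrt (infsum w UNIV)"
      by (rule real_le_rsqrt)
    thus "cmod (fourier_coeff u k) \<le> sqrt (infsum w UNIV) * exp (- \<sigma> * \<bar>real_of_int k\<bar>)"
      by (simp add: E_def exp_minus field_simps)
  qed
qed

lemma hermitian_fourier_coeff: "hermitian (fourier_coeff u)"
  by (simp add: hermitian_def fourier_coeff_def integral_cnj cis_cnj)

lemma Hspace_eq_synth: "u = synth (fourier_coeff u)" if "u \<in> Hspace \<sigma> s"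
proof
  fix x
  have "csynth (fourier_coeff u) x = complex_of_real (u x)"
    using that unfolding csynth_def Hspace_def by (auto intro: infsumI)
  thus "u x = synth (fourier_coeff u) x" by (simp add: synth_def)
qed

text \<open>All sums involved are finite, whatever the weights. Kernel elements turn out to be of
  this kind.\<close>

lemma synth_in_Hspace:
  assumes "hermitian a" "finite S" "\<And>k. k \<notin> S \<Longrightarrow> a k = 0"
  shows "synth a \<in> Hspace \<sigma> s"
proof -
  have r: "rapid a" using rapid_finite_support[OF assms(2,3)] .
  have "((\<lambda>k. a k * cis (of_int k * x)) has_sum csynth a x) UNIV" for x
    unfolding csynth_def by (intro has_sum_infsum csynth_summable r)
  moreover have "(\<lambda>k::int. (cmod (a k))\<^sup>2 * (max 1 \<bar>real_of_int k\<bar>) powr (2 * s)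
            * exp (2 * \<sigma> * \<bar>real_of_int k\<bar>)) summable_on UNIV"
    by (rule summable_on_cong_neutral[THEN iffD1, OF _ _ _ summable_on_finite[OF assms(2)]])
       (use assms(3) in auto)
  ultimately show ?thesis
    by (simp add: Hspace_def periodic_synth fourier_coeff_synth assms r of_real_synth)
qed

section \<open>The kernel in Fourier variables\<close>

text \<open>An odd function such that the symbol of G(0) is \<xi> times it, at finite and infinite
  depth alike; most arguments below then need no case distinction.\<close>

definition tdepth :: "ereal \<Rightarrow> real \<Rightarrow> real" where
  "tdepth h \<xi> = (if h = \<infinity> then sgn \<xi> else tanh (real_of_ereal h * \<xi>))"

lemma tdepth_minus [simp]: "tdepth h (- \<xi>) = - tdepth h \<xi>"
  by (simp add: tdepth_def sgn_minus)

lemma tdepth_abs_le_1: "\<bar>tdepth h \<xi>\<bar> \<le> 1"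
  using tanh_real_lt_1[of "real_of_ereal h * \<xi>"] tanh_real_gt_neg1[of "real_of_ereal h * \<xi>"]
  by (cases "h = \<infinity>") (auto simp: tdepth_def sgn_if)

lemma tdepth_pos: "tdepth h \<xi> > 0" if "h > 0" "\<xi> > 0"
  using that by (cases h) (auto simp: tdepth_def)

lemma tdepth_nonzero: "tdepth h \<xi> \<noteq> 0" if "h > 0" "\<xi> \<noteq> 0"
  using tdepth_pos[OF that(1), of \<xi>] tdepth_pos[OF that(1), of "- \<xi>"] that(2)
  by (cases "\<xi> > 0") auto

definition gsym :: "ereal \<Rightarrow> (int \<Rightarrow> complex) \<Rightarrow> int \<Rightarrow> complex" where
  "gsym h a k = complex_of_real (of_int k * tdepth h (of_int k)) * a k"

lemma rapid_gsym: "rapid (gsym h a)" if "rapid a"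
proof (rule rapid_comparison[OF that, of _ 1 1])
  fix k
  have "cmod (a k) * \<bar>real_of_int k\<bar> * \<bar>tdepth h (of_int k)\<bar> \<le> cmod (a k) * \<bar>real_of_int k\<bar> * 1"
    by (intro mult_left_mono tdepth_abs_le_1) auto
  thus "cmod (gsym h a k) \<le> 1 * (cmod (a k) * \<bar>real_of_int k\<bar> ^ 1)"
    by (simp add: gsym_def norm_mult abs_mult mult_ac)
qed

lemma hermitian_gsym: "hermitian (gsym h a)" if "hermitian a"
  using that by (simp add: hermitian_def gsym_def)

lemma G0_synth: "G0 h (synth a) = synth (gsym h a)" if "hermitian a" "rapid a"
proof -
  have "(if h = \<infinity> then \<bar>\<xi>\<bar> else \<xi> * tanh (real_of_ereal h * \<xi>)) = \<xi> * tdepth h \<xi>" for \<xi>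
    by (simp add: tdepth_def abs_sgn)
  thus ?thesis
    unfolding G0_def by (simp add: fourier_multiplier_synth[OF that] gsym_def[abs_def])
qed

lemmas rapid_intros = rapid_add rapid_diff rapid_scaleR rapid_dsym rapid_isym rapid_psym rapid_gsym

lemmas hermitian_intros = hermitian_add hermitian_diff hermitian_scaleR hermitian_dsym
  hermitian_isym hermitian_psym hermitian_gsym

section \<open>The two components of the linearized operator on coefficients\<close>

definition Lsym1 :: "ereal \<Rightarrow> real \<Rightarrow> real \<Rightarrow> (int \<Rightarrow> complex) \<Rightarrow> (int \<Rightarrow> complex) \<Rightarrow> int \<Rightarrow> complex" where
  "Lsym1 h \<gamma> c a b = c *\<^sub>R dsym a + ((\<gamma> / 2) *\<^sub>R gsym h (isym (psym a)) + gsym h b)"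

definition Lsym2 ::
    "real \<Rightarrow> ereal \<Rightarrow> real \<Rightarrow> real \<Rightarrow> real \<Rightarrow> (int \<Rightarrow> complex) \<Rightarrow> (int \<Rightarrow> complex) \<Rightarrow> int \<Rightarrow> complex" where
  "Lsym2 g h \<kappa> \<gamma> c a b = c *\<^sub>R dsym b - (g *\<^sub>R a - \<kappa> *\<^sub>R dsym (dsym a)
     - (\<gamma>\<^sup>2 / 4) *\<^sub>R psym (isym (gsym h (isym (psym a)))) - (\<gamma> / 2) *\<^sub>R psym (isym (gsym h b)))"

lemma Lop_synth:
  assumes a: "hermitian a" "rapid a" and b: "hermitian b" "rapid b"
  shows "Lop g h \<kappa> \<gamma> c (synth a, synth b)
    = (synth (Lsym1 h \<gamma> c a b), synth (Lsym2 g h \<kappa> \<gamma> c a b))"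
proof -
  note ab = a b hermitian_intros rapid_intros
  have 1: "G0 h (dx_inv (synth (psym a))) = synth (gsym h (isym (psym a)))"
    by (simp add: dx_inv_synth G0_synth ab psym_def)
  have 2: "dx_inv (synth (gsym h (isym (psym a)))) = synth (isym (gsym h (isym (psym a))))"
    by (intro dx_inv_synth ab) (simp add: gsym_def)
  have 3: "dx_inv (synth (gsym h b)) = synth (isym (gsym h b))"
    by (intro dx_inv_synth ab) (simp add: gsym_def)
  have p: "proj0 (synth x) = synth (psym x)" if "hermitian x" "rapid x" for x
    using that by (rule proj0_synth)
  have minus: "x + - y = x - y" for x y :: "real \<Rightarrow> real" by (simp add: fun_eq_iff)
  have f1: "synth (Lsym1 h \<gamma> c a b) = c *\<^sub>R synth (dsym a)
      + ((\<gamma> / 2) *\<^sub>R synth (gsym h (isym (psym a))) + synth (gsym h b))"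
    unfolding Lsym1_def by (simp only: synth_add synth_scaleR ab)
  have f2: "synth (Lsym2 g h \<kappa> \<gamma> c a b) = c *\<^sub>R synth (dsym b) - (g *\<^sub>R synth a
      - \<kappa> *\<^sub>R synth (dsym (dsym a))
      - (\<gamma>\<^sup>2 / 4) *\<^sub>R synth (psym (isym (gsym h (isym (psym a)))))
      - (\<gamma> / 2) *\<^sub>R synth (psym (isym (gsym h b))))"
    unfolding Lsym2_def by (simp only: synth_diff synth_scaleR ab)
  show ?thesis
    unfolding Lop_def hessian_op_def symplectic_J_def f1 f2
    by (simp add: 1 2 3 p deriv_synth G0_synth ab minus)
qed

lemma Lop_synth_eq_0_iff:
  assumes "hermitian a" "rapid a" "hermitian b" "rapid b"
  shows "Lop g h \<kappa> \<gamma> c (synth a, synth b) = 0 \<longleftrightarrow>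
    (\<forall>k. Lsym1 h \<gamma> c a b k = 0 \<and> Lsym2 g h \<kappa> \<gamma> c a b k = 0)"
proof -
  have "hermitian (Lsym1 h \<gamma> c a b)" "rapid (Lsym1 h \<gamma> c a b)"
    "hermitian (Lsym2 g h \<kappa> \<gamma> c a b)" "rapid (Lsym2 g h \<kappa> \<gamma> c a b)"
    unfolding Lsym1_def Lsym2_def by (intro hermitian_intros rapid_intros assms)+
  thus ?thesis
    by (simp add: Lop_synth assms zero_prod_def synth_eq_0_iff) (auto simp: fun_eq_iff)
qed

text \<open>The vanishing of the determinant of a Fourier block. The square root of
  \<open>Omega\<close> is squared away, and with it the choice of branch, which
  \<open>Omega_speed_iff\<close> restores.\<close>

definition disp :: "real \<Rightarrow> ereal \<Rightarrow> real \<Rightarrow> real \<Rightarrow> real \<Rightarrow> real \<Rightarrow> bool" where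
  "disp g h \<kappa> \<gamma> c \<xi> \<longleftrightarrow> c\<^sup>2 * \<xi> = tdepth h \<xi> * (c * \<gamma> + g + \<kappa> * \<xi>\<^sup>2)"

lemma disp_minus [simp]: "disp g h \<kappa> \<gamma> c (- \<xi>) = disp g h \<kappa> \<gamma> c \<xi>"
  by (simp add: disp_def)

text \<open>Obtained by solving the first kernel equation for the second component:
  \<open>b k\<close> is \<open>- \<i>\<close> times this number times \<open>a k\<close>.\<close>

definition alpha :: "ereal \<Rightarrow> real \<Rightarrow> real \<Rightarrow> real \<Rightarrow> real" where
  "alpha h \<gamma> c \<xi> = (c * \<xi> - \<gamma> / 2 * tdepth h \<xi>) / (\<xi> * tdepth h \<xi>)"

lemma alpha_minus [simp]: "alpha h \<gamma> c (- \<xi>) = - alpha h \<gamma> c \<xi>"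
  by (simp add: alpha_def) (simp add: divide_simps)

text \<open>For \<open>g > 0\<close> this forces \<open>a 0 = 0\<close>. The coefficient
  \<open>b 0\<close> does not occur; the zero mean condition of \<open>Hspace0\<close> removes
  it.\<close>

lemma Lsym_zero_mode: "Lsym2 g h \<kappa> \<gamma> c a b 0 = - (complex_of_real g * a 0)"
  by (simp add: Lsym2_def scaleR_fun_def dsym_def psym_def scaleR_conv_of_real)

text \<open>The block has rows \<open>(\<i> * A, \<xi> * t)\<close> and
  \<open>(- E, \<i> * A)\<close>. As \<open>\<xi> * t\<close> is nonzero, the first row determines
  \<open>b k\<close>; inserting it into the second leaves minus the determinant, divided by
  \<open>\<xi> * t\<close>, times \<open>a k\<close>.\<close>

lemma Lsym_mode:
  assumes "h > 0" "k \<noteq> 0"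
  shows "Lsym1 h \<gamma> c a b k = 0 \<and> Lsym2 g h \<kappa> \<gamma> c a b k = 0 \<longleftrightarrow>
    b k = - \<i> * complex_of_real (alpha h \<gamma> c (of_int k)) * a k \<and> (disp g h \<kappa> \<gamma> c (of_int k) \<or> a k = 0)"
proof -
  define \<xi> where "\<xi> = real_of_int k"
  define t where "t = tdepth h \<xi>"
  define A where "A = c * \<xi> - \<gamma> / 2 * t"
  define E where "E = g + \<kappa> * \<xi>\<^sup>2 + \<gamma>\<^sup>2 / 4 * t / \<xi>"
  have nz: "\<xi> \<noteq> 0" "t \<noteq> 0" using assms tdepth_nonzero by (auto simp: \<xi>_def t_def)
  have k: "complex_of_int k = complex_of_real \<xi>" by (simp add: \<xi>_def)
  have nzc: "complex_of_real \<xi> \<noteq> 0" "complex_of_real t \<noteq> 0" using nz by auto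
  have 1: "Lsym1 h \<gamma> c a b k = \<i> * of_real A * a k + of_real (\<xi> * t) * b k"
    using assms(2) nzc
    unfolding Lsym1_def scaleR_fun_def dsym_def psym_def gsym_def isym_def scaleR_conv_of_real A_def
      plus_fun_apply k \<xi>_def[symmetric] t_def[symmetric]
    by (simp add: field_simps)
  have 2: "Lsym2 g h \<kappa> \<gamma> c a b k = \<i> * of_real A * b k - of_real E * a k"
    using assms(2) nzc
    unfolding Lsym2_def scaleR_fun_def dsym_def psym_def gsym_def isym_def scaleR_conv_of_real A_def E_def
      plus_fun_apply minus_apply k \<xi>_def[symmetric] t_def[symmetric]
    by (simp add: field_simps power2_eq_square)
  have al: "alpha h \<gamma> c (of_int k) = A / (\<xi> * t)" by (simp add: alpha_def A_def \<xi>_def t_def)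
  \<comment> \<open>The terms quadratic in \<gamma> cancel, which leaves \<xi> times the difference
    of the two sides of \<open>disp\<close>.\<close>
  have AE: "A\<^sup>2 - E * (\<xi> * t) = \<xi> * (c\<^sup>2 * \<xi> - t * (c * \<gamma> + g + \<kappa> * \<xi>\<^sup>2))"
    using nz by (simp add: A_def E_def field_simps power2_eq_square)
  have d: "disp g h \<kappa> \<gamma> c (of_int k) \<longleftrightarrow> A\<^sup>2 - E * (\<xi> * t) = 0"
    unfolding AE using nz by (simp add: disp_def \<xi>_def t_def)
  have "\<i> * of_real A * a k + of_real (\<xi> * t) * b k = 0 \<longleftrightarrow> b k = - \<i> * of_real (A / (\<xi> * t)) * a k"
    using nzc by (simp add: field_simps add_eq_0_iff)
  moreover have "\<i> * of_real A * b k - of_real E * a k = of_real ((A\<^sup>2 - E * (\<xi> * t)) / (\<xi> * t)) * a k"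
    if "b k = - \<i> * of_real (A / (\<xi> * t)) * a k"
    unfolding that using nzc by (simp add: field_simps power2_eq_square)
  hence "\<i> * of_real A * b k - of_real E * a k = 0 \<longleftrightarrow> A\<^sup>2 - E * (\<xi> * t) = 0 \<or> a k = 0"
    if "b k = - \<i> * of_real (A / (\<xi> * t)) * a k"
    using nz by (simp only: that mult_eq_0_iff of_real_eq_0_iff divide_eq_0_iff simp_thms)
  ultimately show ?thesis
    unfolding 1 2 al d by blast
qed

definition bsym :: "ereal \<Rightarrow> real \<Rightarrow> real \<Rightarrow> (int \<Rightarrow> complex) \<Rightarrow> int \<Rightarrow> complex" where
  "bsym h \<gamma> c a k = - \<i> * complex_of_real (alpha h \<gamma> c (of_int k)) * a k"

lemma hermitian_bsym: "hermitian (bsym h \<gamma> c a)" if "hermitian a"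
  using that by (simp add: hermitian_def bsym_def)

text \<open>Only positive modes are listed: \<open>disp\<close> is even, and Hermitian symmetry ties
  the coefficient at \<open>- n\<close> to the one at \<open>n\<close>.\<close>

definition disp_modes :: "real \<Rightarrow> ereal \<Rightarrow> real \<Rightarrow> real \<Rightarrow> real \<Rightarrow> int set" where
  "disp_modes g h \<kappa> \<gamma> c = {n. n > 0 \<and> disp g h \<kappa> \<gamma> c (of_int n)}"

lemma kerL_imp_synth:
  assumes "\<sigma> > 0" "s \<ge> 0" "g > 0" "h > 0" "u \<in> kerL \<sigma> s g h \<kappa> \<gamma> c"
  obtains a where "hermitian a" "\<And>k. a k \<noteq> 0 \<Longrightarrow> \<bar>k\<bar> \<in> disp_modes g h \<kappa> \<gamma> c"
    and "u = (synth a, synth (bsym h \<gamma> c a))"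
proof -
  define a where "a = fourier_coeff (fst u)"
  define b where "b = fourier_coeff (snd u)"
  have H: "fst u \<in> Hspace \<sigma> s" "snd u \<in> Hspace \<sigma> s" "mean (snd u) = 0"
    and L: "Lop g h \<kappa> \<gamma> c u = 0"
    using assms(5) by (auto simp: kerL_def Hspace0_def)
  have ab: "hermitian a" "rapid a" "hermitian b" "rapid b"
    unfolding a_def b_def by (intro hermitian_fourier_coeff rapid_fourier_coeff[OF _ assms(1,2)] H)+
  have u: "u = (synth a, synth b)"
    using H Hspace_eq_synth unfolding a_def b_def by (metis prod.collapse)
  have "Lop g h \<kappa> \<gamma> c (synth a, synth b) = 0" using L u by simp
  hence L: "Lsym1 h \<gamma> c a b k = 0 \<and> Lsym2 g h \<kappa> \<gamma> c a b k = 0" for k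
    using Lop_synth_eq_0_iff[OF ab] by blast
  \<comment> \<open>The zero mode is absent: \<open>a 0\<close> vanishes by the second kernel
    equation, \<open>b 0\<close> by the zero mean of the second component.\<close>
  have a0: "a 0 = 0" using L[of 0] Lsym_zero_mode[of g h \<kappa> \<gamma> c a b] assms(3) by simp
  have b0: "b 0 = 0" using H(3) of_real_mean_synth[OF ab(3,4)] u by simp
  have k: "b k = bsym h \<gamma> c a k \<and> (disp g h \<kappa> \<gamma> c (of_int k) \<or> a k = 0)" if "k \<noteq> 0" for k
    using Lsym_mode[OF assms(4) that] L[of k] by (simp add: bsym_def)
  have "b k = bsym h \<gamma> c a k" for k
    using k[of k] a0 b0 by (cases "k = 0") (auto simp: bsym_def)
  hence "b = bsym h \<gamma> c a" by (rule ext)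
  moreover have "\<bar>k\<bar> \<in> disp_modes g h \<kappa> \<gamma> c" if "a k \<noteq> 0" for k
    using k[of k] a0 that by (cases "k = 0") (auto simp: disp_modes_def abs_if)
  ultimately show ?thesis using that[of a] ab u by simp
qed

text \<open>Converse of \<open>kerL_imp_synth\<close>. Finitely many modes make both components
  trigonometric polynomials, hence members of the function spaces.\<close>

lemma synth_in_kerL:
  assumes h: "h > 0" and fin: "finite (disp_modes g h \<kappa> \<gamma> c)" and a: "hermitian a"
    and supp: "\<And>k. a k \<noteq> 0 \<Longrightarrow> \<bar>k\<bar> \<in> disp_modes g h \<kappa> \<gamma> c"
  shows "(synth a, synth (bsym h \<gamma> c a)) \<in> kerL \<sigma> s g h \<kappa> \<gamma> c"
proof -
  let ?S = "disp_modes g h \<kappa> \<gamma> c"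
  let ?b = "bsym h \<gamma> c a"
  have F: "finite (?S \<union> uminus ` ?S)" using fin by simp
  have sa: "a k = 0" if "k \<notin> ?S \<union> uminus ` ?S" for k
    using supp[of k] that by (force simp: abs_if split: if_splits)
  hence sb: "?b k = 0" if "k \<notin> ?S \<union> uminus ` ?S" for k using that by (simp add: bsym_def)
  have ab: "hermitian a" "rapid a" "hermitian ?b" "rapid ?b"
    using a hermitian_bsym rapid_finite_support[OF F sa] rapid_finite_support[OF F sb] by auto
  have a0: "a 0 = 0" using supp[of 0] by (auto simp: disp_modes_def)
  have "complex_of_real (mean (synth ?b)) = 0"
    using of_real_mean_synth[OF ab(3,4)] a0 by (simp add: bsym_def)
  moreover have "Lsym1 h \<gamma> c a ?b k = 0 \<and> Lsym2 g h \<kappa> \<gamma> c a ?b k = 0" for k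
  proof (cases "k = 0")
    case True
    thus ?thesis using a0 Lsym_zero_mode[of g h \<kappa> \<gamma> c a ?b]
      by (simp add: Lsym1_def scaleR_fun_def dsym_def gsym_def)
  next
    case False
    have "disp g h \<kappa> \<gamma> c (of_int k)" if "a k \<noteq> 0"
      using supp[OF that] by (auto simp: disp_modes_def abs_if split: if_splits)
    thus ?thesis using Lsym_mode[OF h False] by (auto simp: bsym_def)
  qed
  hence "Lop g h \<kappa> \<gamma> c (synth a, synth ?b) = 0" using Lop_synth_eq_0_iff[OF ab] by blast
  ultimately show ?thesis
    using synth_in_Hspace[OF ab(1) F sa] synth_in_Hspace[OF ab(3) F sb]
    by (simp add: kerL_def Hspace0_def)
qed

section \<open>A real basis of the kernel\<close>

definition mode :: "int \<Rightarrow> complex \<Rightarrow> int \<Rightarrow> complex" where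
  "mode n z k = (if k = n then z else if k = - n then cnj z else 0)"

lemma hermitian_mode: "hermitian (mode n z)" if "n > 0"
  using that by (auto simp: hermitian_def mode_def)

lemma sum_fun_apply: "(\<Sum>i\<in>I. f i) x = (\<Sum>i\<in>I. f i x)"
  by (induction I rule: infinite_finite_induct) auto

text \<open>Finite sums make this linear on all coefficient functions, convergent or not, as
  \<open>linear\<close> demands. On those supported in \<open>F\<close> it agrees with
  synthesis.\<close>

definition finite_synth ::
    "ereal \<Rightarrow> real \<Rightarrow> real \<Rightarrow> int set \<Rightarrow> (int \<Rightarrow> complex) \<Rightarrow> (real \<Rightarrow> real) \<times> (real \<Rightarrow> real)" where
  "finite_synth h \<gamma> c F a =
     ((\<lambda>x. \<Sum>k\<in>F. Re (a k * cis (of_int k * x))), (\<lambda>x. \<Sum>k\<in>F. Re (bsym h \<gamma> c a k * cis (of_int k * x))))"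

lemma linear_finite_synth: "linear (finite_synth h \<gamma> c F)"
proof (rule linearI)
  fix a b :: "int \<Rightarrow> complex" and r :: real
  have "bsym h \<gamma> c (a + b) k = bsym h \<gamma> c a k + bsym h \<gamma> c b k" for k
    by (simp add: bsym_def distrib_left)
  thus "finite_synth h \<gamma> c F (a + b) = finite_synth h \<gamma> c F a + finite_synth h \<gamma> c F b"
    by (simp only: finite_synth_def plus_fun_apply distrib_right plus_complex.sel sum.distrib
        plus_prod_def fst_conv snd_conv) (simp add: fun_eq_iff)
  have "bsym h \<gamma> c (r *\<^sub>R a) k = r *\<^sub>R bsym h \<gamma> c a k" for k
    by (simp add: bsym_def scaleR_fun_def)
  thus "finite_synth h \<gamma> c F (r *\<^sub>R a) = r *\<^sub>R finite_synth h \<gamma> c F a"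
    by (simp only: finite_synth_def scaleR_fun_def mult_scaleR_left scaleR_complex.sel
        sum_distrib_left scaleR_prod_def fst_conv snd_conv real_scaleR_def)
qed

lemma finite_synth_eq:
  assumes "finite F" "\<And>k. k \<notin> F \<Longrightarrow> a k = 0"
  shows "finite_synth h \<gamma> c F a = (synth a, synth (bsym h \<gamma> c a))"
  using assms by (simp add: finite_synth_def fun_eq_iff synth_finite_support[of F] bsym_def)

lemma dim_kerL:
  assumes "\<sigma> > 0" "s \<ge> 0" "g > 0" and h: "h > 0" and fin: "finite (disp_modes g h \<kappa> \<gamma> c)"
  shows "dim (kerL \<sigma> s g h \<kappa> \<gamma> c) = 2 * card (disp_modes g h \<kappa> \<gamma> c)"
proof -
  define S where "S = disp_modes g h \<kappa> \<gamma> c"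
  define F where "F = S \<union> uminus ` S"
  \<comment> \<open>Each positive mode \<open>n\<close> contributes two real directions,
    \<open>mode n 1\<close> and \<open>mode n \<i>\<close>.\<close>
  define I where "I = S \<times> {1, \<i>}"
  define V where "V = finite_synth h \<gamma> c F"
  define m where "m = (\<lambda>(n, z). mode n z)"
  define lc where "lc = (\<lambda>r::int \<times> complex \<Rightarrow> real. \<Sum>p\<in>I. r p *\<^sub>R m p)"
  have pos: "n > 0" if "n \<in> S" for n using that by (simp add: S_def disp_modes_def)
  have finS: "finite S" "finite F" "finite I" using fin by (auto simp: S_def F_def I_def)
  have linV: "linear V" by (simp add: V_def linear_finite_synth)
  have lc_eq: "lc r k = (\<Sum>n\<in>S. r (n, 1) *\<^sub>R mode n 1 k + r (n, \<i>) *\<^sub>R mode n \<i> k)" for r k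
    unfolding lc_def sum_fun_apply I_def sum.cartesian_product[symmetric, unfolded split_def]
    by (simp add: m_def scaleR_fun_def sum.Sigma[symmetric] finS sum.cartesian_product' )
  \<comment> \<open>Since all elements of \<open>S\<close> are positive, the conjugate entries at
    negative indices do not interfere, and the coordinates appear as real and imaginary
    parts.\<close>
  have lc_S: "lc r n = Complex (r (n, 1)) (r (n, \<i>))" if "n \<in> S" for r n
  proof -
    have "lc r n = (\<Sum>n'\<in>S. if n' = n then Complex (r (n, 1)) (r (n, \<i>)) else 0)"
      unfolding lc_eq
    proof (intro sum.cong refl)
      fix n' assume "n' \<in> S"
      thus "r (n', 1) *\<^sub>R mode n' 1 n + r (n', \<i>) *\<^sub>R mode n' \<i> n
          = (if n' = n then Complex (r (n, 1)) (r (n, \<i>)) else 0)"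
        using pos[of n'] pos[OF that] by (auto simp: mode_def complex_eq_iff)
    qed
    also have "\<dots> = Complex (r (n, 1)) (r (n, \<i>))" using that finS by simp
    finally show ?thesis .
  qed
  have lc_supp: "lc r k = 0" if "k \<notin> F" for r k
    unfolding lc_eq by (rule sum.neutral) (use that in \<open>auto simp: mode_def F_def\<close>)
  have lc_herm: "hermitian (lc r)" for r
    unfolding hermitian_def lc_eq
    using hermitian_mode[OF pos] by (auto simp: hermitian_def intro!: sum.cong)
  have m_lc: "m p = lc (\<lambda>q. if q = p then 1 else 0)" if "p \<in> I" for p
  proof -
    have "lc (\<lambda>q. if q = p then 1 else 0) = (\<Sum>q\<in>I. if q = p then m p else 0)"
      unfolding lc_def by (intro sum.cong refl) (auto simp: scaleR_fun_def fun_eq_iff)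
    thus ?thesis using that finS by simp
  qed
  have herm_eqI: "a = b" if "hermitian a" "hermitian b" "\<And>k. k \<notin> F \<Longrightarrow> a k = 0" "\<And>k. k \<notin> F \<Longrightarrow> b k = 0"
      "\<And>n. n \<in> S \<Longrightarrow> a n = b n" for a b :: "int \<Rightarrow> complex"
  proof
    fix k
    show "a k = b k"
    proof (cases "k \<in> F")
      case True
      then consider "k \<in> S" | "- k \<in> S" by (auto simp: F_def)
      thus ?thesis
      proof cases
        case 2
        hence "cnj (a k) = cnj (b k)" using that(5)[of "- k"] that(1,2) by (simp add: hermitian_def)
        thus ?thesis by simp
      qed (use that in auto)
    qed (use that in auto)
  qed
  have V_lc: "V (lc r) = (\<Sum>p\<in>I. r p *\<^sub>R V (m p))" for r
    unfolding lc_def by (simp add: linear_sum[OF linV] linear_scale[OF linV])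
  have V_synth: "V (lc r) = (synth (lc r), synth (bsym h \<gamma> c (lc r)))" for r
    unfolding V_def by (intro finite_synth_eq finS lc_supp)
  have lc_0: "r p = 0" if "V (lc r) = 0" "p \<in> I" for r p
  proof -
    have "synth (lc r) = 0" using that(1) V_synth by (simp add: zero_prod_def)
    hence "lc r = 0"
      using synth_eq_0_iff[OF lc_herm rapid_finite_support[OF finS(2) lc_supp]] by blast
    thus ?thesis using lc_S[of "fst p" r] that(2) by (auto simp: I_def zero_complex.code)
  qed
  have lc_diff: "lc r - lc r' = lc (\<lambda>p. r p - r' p)" for r r'
    by (simp add: lc_def sum_subtractf[symmetric] scaleR_diff_left)
  have inj: "inj_on (\<lambda>p. V (m p)) I"
  proof (rule inj_onI)
    fix p q assume pq: "p \<in> I" "q \<in> I" "V (m p) = V (m q)"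
    \<comment> \<open>The difference of the indicators of \<open>p\<close> and \<open>q\<close>; for
      distinct \<open>p\<close> and \<open>q\<close> its value at \<open>p\<close> would be 1,
      against \<open>lc_0\<close>.\<close>
    let ?r = "\<lambda>x. (if x = p then 1 else 0) - (if x = q then 1 else 0) :: real"
    have "V (lc ?r) = 0"
      using pq by (simp add: lc_diff[symmetric] linear_diff[OF linV] m_lc[symmetric])
    from lc_0[OF this pq(1)] show "p = q" by (auto split: if_splits)
  qed
  define B where "B = (\<lambda>p. V (m p)) ` I"
  have "B \<subseteq> kerL \<sigma> s g h \<kappa> \<gamma> c"
  proof
    fix u assume "u \<in> B"
    then obtain r where r: "u = V (lc r)" unfolding B_def using m_lc by auto
    have "\<bar>k\<bar> \<in> S" if "lc r k \<noteq> 0" for k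
      using lc_supp[of k r] that pos by (force simp: F_def abs_if)
    thus "u \<in> kerL \<sigma> s g h \<kappa> \<gamma> c"
      unfolding r V_synth by (intro synth_in_kerL h fin lc_herm) (simp add: S_def)
  qed
  moreover have "kerL \<sigma> s g h \<kappa> \<gamma> c \<subseteq> span B"
  proof
    fix u assume "u \<in> kerL \<sigma> s g h \<kappa> \<gamma> c"
    then obtain a where a: "hermitian a" "\<And>k. a k \<noteq> 0 \<Longrightarrow> \<bar>k\<bar> \<in> S" "u = (synth a, synth (bsym h \<gamma> c a))"
      using kerL_imp_synth[OF assms(1-4)] unfolding S_def by metis
    define r where "r = (\<lambda>(n :: int, z :: complex). if z = 1 then Re (a n) else Im (a n))"
    have "a = lc r"
    proof (rule herm_eqI[OF a(1) lc_herm _ lc_supp])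
      fix k assume "k \<notin> F"
      thus "a k = 0" using a(2)[of k] by (force simp: F_def abs_if split: if_splits)
    next
      fix n assume "n \<in> S"
      thus "a n = lc r n" by (simp add: lc_S r_def complex_eq_iff)
    qed
    hence u: "u = (\<Sum>p\<in>I. r p *\<^sub>R V (m p))" using a(3) V_synth V_lc by metis
    show "u \<in> span B"
      unfolding u by (intro span_sum span_scale span_base) (simp add: B_def)
  qed
  moreover have "independent B"
  proof (rule independent_if_scalars_zero)
    fix f x assume f: "(\<Sum>x\<in>B. f x *\<^sub>R x) = 0" and x: "x \<in> B"
    have "V (lc (\<lambda>p. f (V (m p)))) = 0"
      using f by (simp only: V_lc B_def sum.reindex[OF inj] comp_def)
    moreover obtain p where "x = V (m p)" "p \<in> I" using x unfolding B_def by (rule imageE)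
    ultimately show "f x = 0" using lc_0 by blast
  qed (use finS in \<open>simp add: B_def\<close>)
  moreover have "card B = 2 * card S"
    using inj by (simp add: B_def card_image I_def card_cartesian_product)
  ultimately show ?thesis unfolding S_def by (rule dim_unique)
qed

section \<open>Counting resonant modes\<close>

lemma disp_xcoth:
  assumes "H > 0" "\<xi> > 0"
  shows "disp g (ereal H) \<kappa> \<gamma> c \<xi> \<longleftrightarrow>
    c\<^sup>2 / H * xcoth (H * \<xi>) - \<kappa> / H\<^sup>2 * (H * \<xi>)\<^sup>2 = c * \<gamma> + g"
proof -
  have t: "tanh (H * \<xi>) > 0" using assms by simp
  have "xcoth (H * \<xi>) = H * \<xi> / tanh (H * \<xi>)" by (simp add: xcoth_def tanh_def)
  hence "c\<^sup>2 / H * xcoth (H * \<xi>) - \<kappa> / H\<^sup>2 * (H * \<xi>)\<^sup>2 = c\<^sup>2 * \<xi> / tanh (H * \<xi>) - \<kappa> * \<xi>\<^sup>2"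
    using assms by (simp add: power_mult_distrib)
  moreover have "disp g (ereal H) \<kappa> \<gamma> c \<xi> \<longleftrightarrow> c\<^sup>2 * \<xi> / tanh (H * \<xi>) = c * \<gamma> + g + \<kappa> * \<xi>\<^sup>2"
    using t assms by (subst divide_eq_eq) (simp add: disp_def tdepth_def mult.commute)
  ultimately show ?thesis by auto
qed

lemma disp_infinite_depth:
  "disp g \<infinity> \<kappa> \<gamma> c \<xi> \<longleftrightarrow> c\<^sup>2 * \<xi> = c * \<gamma> + g + \<kappa> * \<xi>\<^sup>2" if "\<xi> > 0"
  using that by (simp add: disp_def tdepth_def)

lemma disp_at_most_two:
  assumes "h > 0" "c \<noteq> 0" "0 < x" "x < y" "y < z"
    and "disp g h \<kappa> \<gamma> c x" "disp g h \<kappa> \<gamma> c y" "disp g h \<kappa> \<gamma> c z"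
  shows False
proof (cases h)
  case (real H)
  hence H: "H > 0" using assms(1) by simp
  show False
    by (rule xcoth_quadratic_at_most_two[of "c\<^sup>2 / H" "H * x" "H * y" "H * z" "\<kappa> / H\<^sup>2" "c * \<gamma> + g"])
       (use assms H in \<open>simp_all only: real disp_xcoth less_trans[OF assms(3,4)]
          less_trans[OF less_trans[OF assms(3,4)] assms(5)]\<close>, simp_all)
next
  case PInf
  have d: "c\<^sup>2 * x = c * \<gamma> + g + \<kappa> * x\<^sup>2" "c\<^sup>2 * y = c * \<gamma> + g + \<kappa> * y\<^sup>2" "c\<^sup>2 * z = c * \<gamma> + g + \<kappa> * z\<^sup>2"
    using assms by (auto simp: PInf disp_infinite_depth)
  \<comment> \<open>Subtracting consecutive equations and dividing by the gaps gives
    \<open>c^2 = \<kappa> * (x + y) = \<kappa> * (y + z)\<close>. As \<open>c\<close> is nonzero so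
    is \<kappa>, whence \<open>x = z\<close>.\<close>
  have "(y - x) * (c\<^sup>2 - \<kappa> * (x + y)) = 0" "(z - y) * (c\<^sup>2 - \<kappa> * (y + z)) = 0"
    using d by (simp_all add: algebra_simps power2_eq_square)
  hence "c\<^sup>2 = \<kappa> * (x + y)" "c\<^sup>2 = \<kappa> * (y + z)" using assms by auto
  moreover from this have "\<kappa> \<noteq> 0" using assms by auto
  ultimately show False using assms by auto
qed (use assms in auto)

section \<open>Long-wave speed and Bond numbers\<close>

lemma Bond_plus_less_third:
  assumes g: "g > 0" and H: "H > 0" and c: "c > 0"
    and k: "\<kappa> < c\<^sup>2 * H / 3" and le: "c\<^sup>2 \<le> H * (c * \<gamma> + g)"
  shows "Bond_plus g H \<kappa> \<gamma> < 1 / 3"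
proof -
  \<comment> \<open>With this \<open>R\<close>, \<open>d\<close> is the positive root of
    \<open>X^2 = H * (X * \<gamma> + g)\<close>, the long-wave speed; the assumption
    \<open>le\<close> yields \<open>c \<le> d\<close>.\<close>
  define R where "R = sqrt (g * H + (\<gamma> * H / 2)\<^sup>2)"
  define d where "d = \<gamma> * H / 2 + R"
  have R2: "R\<^sup>2 = g * H + (\<gamma> * H / 2)\<^sup>2" using g H by (simp add: R_def)
  have d2: "d\<^sup>2 = H * (d * \<gamma> + g)"
    using R2 by (simp add: d_def power2_eq_square algebra_simps)
  have "(c - \<gamma> * H / 2)\<^sup>2 \<le> R\<^sup>2" unfolding R2 using le by (simp add: power2_eq_square algebra_simps)
  hence "c - \<gamma> * H / 2 \<le> R" by (rule power2_le_imp_le) (use g H in \<open>simp add: R_def\<close>)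
  hence "c\<^sup>2 \<le> d\<^sup>2" using c by (intro power_mono) (auto simp: d_def)
  hence "c\<^sup>2 * H \<le> d\<^sup>2 * H" by (rule mult_right_mono) (use H in simp)
  hence "\<kappa> < d\<^sup>2 * H / 3" using k by linarith
  also have "\<dots> = H\<^sup>2 * (d * \<gamma> + g) / 3" unfolding d2 by (simp add: power2_eq_square)
  finally have "\<kappa> / (g * H\<^sup>2) < H\<^sup>2 * (d * \<gamma> + g) / 3 / (g * H\<^sup>2)"
    by (rule divide_strict_right_mono) (use g H in simp)
  also have "\<dots> = (d * \<gamma> + g) / (3 * g)" using H by simp
  finally have "\<kappa> / (g * H\<^sup>2) < (d * \<gamma> + g) / (3 * g)" .
  \<comment> \<open>Taking \<open>\<bar>\<gamma>\<bar> * H / 2\<close> out of the root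
    \<open>R\<close> produces \<open>\<bar>\<gamma>\<bar> * \<gamma>\<close>, the source of the
    factor \<open>sgn \<gamma>\<close> in the Bond number.\<close>
  moreover have "H * \<gamma>\<^sup>2 / (6 * g) * (1 + sgn \<gamma> * sqrt (1 + 4 * g / (H * \<gamma>\<^sup>2))) = d * \<gamma> / (3 * g)"
  proof (cases "\<gamma> = 0")
    case False
    have "R = sqrt ((\<bar>\<gamma>\<bar> * H / 2)\<^sup>2 * (1 + 4 * g / (H * \<gamma>\<^sup>2)))"
      unfolding R_def using False H by (simp add: field_simps power2_eq_square)
    also have "\<dots> = \<bar>\<gamma>\<bar> * H / 2 * sqrt (1 + 4 * g / (H * \<gamma>\<^sup>2))"
      unfolding real_sqrt_mult real_sqrt_abs using H by simp
    finally have "R * \<gamma> = (\<bar>\<gamma>\<bar> * \<gamma>) * H / 2 * sqrt (1 + 4 * g / (H * \<gamma>\<^sup>2))" by simp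
    also have "\<bar>\<gamma>\<bar> * \<gamma> = sgn \<gamma> * \<gamma>\<^sup>2" by (simp add: abs_sgn power2_eq_square)
    finally have "R * \<gamma> = sgn \<gamma> * \<gamma>\<^sup>2 * H / 2 * sqrt (1 + 4 * g / (H * \<gamma>\<^sup>2))" .
    note R = this
    have "d * \<gamma> = H * \<gamma>\<^sup>2 / 2 + R * \<gamma>"
      by (simp add: d_def algebra_simps power2_eq_square)
    also have "\<dots> = H * \<gamma>\<^sup>2 / 2 * (1 + sgn \<gamma> * sqrt (1 + 4 * g / (H * \<gamma>\<^sup>2)))"
      unfolding R by (simp add: distrib_left)
    finally have "d * \<gamma> = H * \<gamma>\<^sup>2 / 2 * (1 + sgn \<gamma> * sqrt (1 + 4 * g / (H * \<gamma>\<^sup>2)))" .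
    note d = this
    have "H * \<gamma>\<^sup>2 / (6 * g) * Z = H * \<gamma>\<^sup>2 / 2 * Z / (3 * g)" for Z by simp
    thus ?thesis unfolding d .
  qed simp
  moreover have "(d * \<gamma> + g) / (3 * g) = d * \<gamma> / (3 * g) + 1 / 3"
    using g by (simp add: add_divide_distrib)
  ultimately show ?thesis unfolding Bond_plus_def by linarith
qed

text \<open>Reversing the direction of propagation negates both \<open>c\<close> and \<gamma>, so
  negative speeds reduce to positive ones.\<close>

lemma Bond_minus_conv_plus: "Bond_minus g H \<kappa> \<gamma> = Bond_plus g H \<kappa> (- \<gamma>)"
  by (simp add: Bond_minus_def Bond_plus_def sgn_minus)

lemma disp_two_solutions:
  assumes "g > 0" "h > 0" "c \<noteq> 0" "0 < x" "x < y"
    and "disp g h \<kappa> \<gamma> c x" "disp g h \<kappa> \<gamma> c y"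
  shows "case_i g h \<kappa> \<gamma> c \<or> case_ii h \<kappa>"
proof (cases h)
  case (real H)
  hence H: "H > 0" using assms(2) by simp
  have "0 < \<kappa> / H\<^sup>2" "\<kappa> / H\<^sup>2 < c\<^sup>2 / H / 3" "c\<^sup>2 / H \<le> c * \<gamma> + g"
    using xcoth_quadratic_two_solutions[of "c\<^sup>2 / H" "H * x" "H * y" "\<kappa> / H\<^sup>2" "c * \<gamma> + g"] assms H
      disp_xcoth[OF H, of x g \<kappa> \<gamma> c] disp_xcoth[OF H, of y g \<kappa> \<gamma> c]
    by (auto simp: real)
  hence k: "0 < \<kappa>" "\<kappa> < c\<^sup>2 * H / 3" "c\<^sup>2 \<le> H * (c * \<gamma> + g)"
    using H by (simp_all add: field_simps zero_less_divide_iff power2_eq_square)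
  have "Bond_plus g H \<kappa> \<gamma> < 1 / 3" if "c > 0"
    using Bond_plus_less_third[OF assms(1) H that k(2,3)] .
  moreover have "Bond_minus g H \<kappa> \<gamma> < 1 / 3" if "c < 0"
    unfolding Bond_minus_conv_plus
    using Bond_plus_less_third[OF assms(1) H, of "- c" \<kappa> "- \<gamma>"] that k by simp
  ultimately show ?thesis using k by (simp add: case_i_def real)
next
  case PInf
  \<comment> \<open>Subtracting the two equations gives \<open>c^2 = \<kappa> * (x + y)\<close>,
    with both \<open>c^2\<close> and \<open>x + y\<close> positive.\<close>
  have "(y - x) * (c\<^sup>2 - \<kappa> * (x + y)) = 0"
    using assms by (simp add: PInf disp_infinite_depth algebra_simps power2_eq_square)
  hence "c\<^sup>2 = \<kappa> * (x + y)" using assms by auto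
  hence "\<kappa> > 0" using assms by (metis add_pos_pos less_trans zero_less_mult_pos2 zero_less_power2)
  thus ?thesis by (simp add: case_ii_def PInf)
qed (use assms in auto)

lemma card_le_2I:
  fixes S :: "'a :: linorder set"
  assumes "\<And>x y z. x \<in> S \<Longrightarrow> y \<in> S \<Longrightarrow> z \<in> S \<Longrightarrow> x < y \<Longrightarrow> y < z \<Longrightarrow> False"
  shows "finite S" "card S \<le> 2"
proof -
  have *: "\<not> (T \<subseteq> S \<and> finite T \<and> card T = 3)" for T
  proof
    assume "T \<subseteq> S \<and> finite T \<and> card T = 3"
    then obtain x y z where T: "T = {x, y, z}" "x \<noteq> y" "y \<noteq> z" "x \<noteq> z" and "T \<subseteq> S"
      unfolding card_3_iff by blast
    hence S: "x \<in> S" "y \<in> S" "z \<in> S" by auto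
    show False
      using S T(2-4) assms[of x y z] assms[of x z y] assms[of y x z] assms[of y z x]
        assms[of z x y] assms[of z y x]
      unfolding neq_iff by blast
  qed
  show "finite S" using * infinite_arbitrarily_large by blast
  show "card S \<le> 2"
  proof (rule ccontr)
    assume "\<not> card S \<le> 2"
    hence "3 \<le> card S" by simp
    thus False using * \<open>finite S\<close> by (metis obtain_subset_with_card_n finite_subset)
  qed
qed

lemma disp_modes_card_le_2:
  assumes "h > 0" "c \<noteq> 0"
  shows "finite (disp_modes g h \<kappa> \<gamma> c)" "card (disp_modes g h \<kappa> \<gamma> c) \<le> 2"
proof -
  have *: False if "x \<in> disp_modes g h \<kappa> \<gamma> c" "y \<in> disp_modes g h \<kappa> \<gamma> c" "z \<in> disp_modes g h \<kappa> \<gamma> c"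
      "x < y" "y < z" for x y z
    using disp_at_most_two[OF assms, of "of_int x" "of_int y" "of_int z" g \<kappa> \<gamma>] that
    by (simp add: disp_modes_def)
  show "finite (disp_modes g h \<kappa> \<gamma> c)"
    by (rule card_le_2I(1)) (erule (4) *)
  show "card (disp_modes g h \<kappa> \<gamma> c) \<le> 2"
    by (rule card_le_2I(2)) (erule (4) *)
qed

section \<open>Phase speeds and the dispersion condition\<close>

lemma Omega_tdepth:
  "Omega g h \<kappa> \<gamma> \<xi> = \<gamma> / 2 * tdepth h \<xi>
     + sqrt ((g + \<kappa> * \<xi>\<^sup>2) * (\<xi> * tdepth h \<xi>) + (\<gamma> / 2 * tdepth h \<xi>)\<^sup>2)" if "\<xi> \<noteq> 0"
proof (cases "h = \<infinity>")
  case True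
  have "(\<gamma> / 2 * sgn \<xi>)\<^sup>2 = \<gamma>\<^sup>2 / 4" using that by (auto simp: sgn_if power_divide)
  thus ?thesis using True by (simp add: Omega_def tdepth_def abs_sgn[of \<xi>])
next
  case False
  thus ?thesis by (simp add: Omega_def tdepth_def Let_def power_mult_distrib power_divide mult_ac)
qed

lemma mult_tdepth_pos: "\<xi> * tdepth h \<xi> > 0" if "h > 0" "\<xi> \<noteq> 0"
  using tdepth_pos[OF that(1), of \<xi>] tdepth_pos[OF that(1), of "- \<xi>"] that(2)
  by (cases "\<xi> > 0") (auto simp: mult_neg_neg)

text \<open>The dispersion condition is the quadratic equation
  \<open>X * (X - \<gamma> * t) = Q\<close> for \<open>X = c * \<xi>\<close>. As
  \<open>Q > 0\<close>, its roots have opposite signs, and \<open>Omega\<close> is the positive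
  one.\<close>

lemma Omega_speed_iff:
  assumes "g > 0" "\<kappa> \<ge> 0" "h > 0" "\<xi> \<noteq> 0"
  shows "Omega g h \<kappa> \<gamma> \<xi> / \<xi> = c \<longleftrightarrow> c * \<xi> > 0 \<and> disp g h \<kappa> \<gamma> c \<xi>"
proof -
  define t where "t = tdepth h \<xi>"
  define Q where "Q = (g + \<kappa> * \<xi>\<^sup>2) * (\<xi> * t)"
  have "g + \<kappa> * \<xi>\<^sup>2 > 0" using assms by (simp add: add_pos_nonneg)
  hence Q: "Q > 0" using mult_tdepth_pos[OF assms(3,4)] by (simp add: Q_def t_def)
  have O: "Omega g h \<kappa> \<gamma> \<xi> = \<gamma> / 2 * t + sqrt (Q + (\<gamma> / 2 * t)\<^sup>2)"
    by (simp add: Omega_tdepth[OF assms(4)] t_def Q_def)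
  have d: "disp g h \<kappa> \<gamma> c \<xi> \<longleftrightarrow> (c * \<xi>) * (c * \<xi> - \<gamma> * t) = Q"
  proof -
    have "(c * \<xi>) * (c * \<xi> - \<gamma> * t) - Q = \<xi> * (c\<^sup>2 * \<xi> - t * (c * \<gamma> + g + \<kappa> * \<xi>\<^sup>2))"
      by (simp add: Q_def algebra_simps power2_eq_square)
    hence "(c * \<xi>) * (c * \<xi> - \<gamma> * t) = Q \<longleftrightarrow> c\<^sup>2 * \<xi> - t * (c * \<gamma> + g + \<kappa> * \<xi>\<^sup>2) = 0"
      using assms(4) by (metis eq_iff_diff_eq_0 mult_eq_0_iff)
    thus ?thesis by (simp add: disp_def t_def)
  qed
  have s: "\<bar>\<gamma> / 2 * t\<bar> < sqrt (Q + (\<gamma> / 2 * t)\<^sup>2)"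
    by (rule real_less_rsqrt) (simp only: power2_abs, use Q in simp)
  have "c * \<xi> = \<gamma> / 2 * t + sqrt (Q + (\<gamma> / 2 * t)\<^sup>2) \<longleftrightarrow> c * \<xi> > 0 \<and> (c * \<xi>) * (c * \<xi> - \<gamma> * t) = Q"
  proof
    assume e: "c * \<xi> = \<gamma> / 2 * t + sqrt (Q + (\<gamma> / 2 * t)\<^sup>2)"
    have "(c * \<xi> - \<gamma> / 2 * t)\<^sup>2 = Q + (\<gamma> / 2 * t)\<^sup>2" using e Q by simp
    hence "(c * \<xi>) * (c * \<xi> - \<gamma> * t) = Q" by (simp add: power2_eq_square algebra_simps)
    thus "c * \<xi> > 0 \<and> (c * \<xi>) * (c * \<xi> - \<gamma> * t) = Q" using e s by linarith
  next
    assume e: "c * \<xi> > 0 \<and> (c * \<xi>) * (c * \<xi> - \<gamma> * t) = Q"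
    \<comment> \<open>Both factors of \<open>Q\<close> are positive, hence so is their mean
      \<open>c * \<xi> - \<gamma> / 2 * t\<close>, which is therefore the nonnegative square
      root.\<close>
    hence "c * \<xi> - \<gamma> * t > 0" using Q by (metis zero_less_mult_pos)
    hence "c * \<xi> - \<gamma> / 2 * t \<ge> 0" using e by (simp add: mult.commute)
    moreover have "(c * \<xi> - \<gamma> / 2 * t)\<^sup>2 = Q + (\<gamma> / 2 * t)\<^sup>2"
      using e by (simp add: power2_eq_square algebra_simps)
    ultimately have "sqrt (Q + (\<gamma> / 2 * t)\<^sup>2) = c * \<xi> - \<gamma> / 2 * t" by (metis real_sqrt_unique)
    thus "c * \<xi> = \<gamma> / 2 * t + sqrt (Q + (\<gamma> / 2 * t)\<^sup>2)" by simp
  qed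
  moreover have "Omega g h \<kappa> \<gamma> \<xi> / \<xi> = c \<longleftrightarrow> c * \<xi> = Omega g h \<kappa> \<gamma> \<xi>"
    using assms(4) nonzero_eq_divide_eq by metis
  ultimately show ?thesis unfolding d O by simp
qed

section \<open>Surface tensions with two prescribed resonant modes\<close>

lemma mult_tdepth_strict_mono: "x * tdepth h x < y * tdepth h y" if "h > 0" "0 < x" "x < y"
proof -
  have "tdepth h x \<le> tdepth h y"
    using that by (cases h) (auto simp: tdepth_def)
  thus ?thesis using that tdepth_pos[OF that(1), of x] by (intro mult_less_le_imp_less) auto
qed

lemma divide_tdepth_strict_mono: "x / tdepth h x < y / tdepth h y" if "h > 0" "0 < x" "x < y"
proof (cases h)
  case (real H)
  hence H: "H > 0" using that by simp
  hence "H * x / tanh (H * x) < H * y / tanh (H * y)"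
    using xcoth_strict_mono[of "H * x" "H * y"] that by (simp add: xcoth_def tanh_def)
  hence "H * (x / tanh (H * x)) < H * (y / tanh (H * y))" by (simp only: times_divide_eq_right)
  thus ?thesis unfolding mult_less_cancel_left_pos[OF H] by (simp add: real tdepth_def)
qed (use that in \<open>auto simp: tdepth_def\<close>)

lemma exists_resonant_tension:
  assumes "g > 0" "h > 0" "0 < x" "x < y"
  obtains \<kappa> c where "\<kappa> > 0" "c > 0" "disp g h \<kappa> \<gamma> c x" "disp g h \<kappa> \<gamma> c y"
proof -
  \<comment> \<open>The two conditions read
    \<open>c^2 * U = c * \<gamma> + g + \<kappa> * x^2\<close> and
    \<open>c^2 * V = c * \<gamma> + g + \<kappa> * y^2\<close>. Eliminating \<kappa> gives
    \<open>A * c^2 = B * (c * \<gamma> + g)\<close>; subtracting gives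
    \<open>\<kappa> * B = c^2 * (V - U)\<close>. The two monotonicity lemmas yield
    \<open>A > 0\<close> and \<open>U < V\<close>.\<close>
  define U V where "U = x / tdepth h x" and "V = y / tdepth h y"
  define A where "A = y\<^sup>2 * U - x\<^sup>2 * V"
  define B where "B = y\<^sup>2 - x\<^sup>2"
  have t: "tdepth h x > 0" "tdepth h y > 0" using tdepth_pos assms by auto
  have "y\<^sup>2 * U - x\<^sup>2 * V = x * y * (y * tdepth h y - x * tdepth h x) / (tdepth h x * tdepth h y)"
    using t by (simp add: U_def V_def field_simps power2_eq_square)
  moreover have "x * y * (y * tdepth h y - x * tdepth h x) > 0"
    using mult_tdepth_strict_mono[OF assms(2-4)] assms by simp
  ultimately have A: "A > 0" using t by (simp add: A_def)
  have B: "B > 0" using assms by (simp add: B_def power_strict_mono)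
  have UV: "U < V" using divide_tdepth_strict_mono[OF assms(2-4)] by (simp add: U_def V_def)
  \<comment> \<open>The root of the discriminant of the equation for \<open>c\<close>; it exceeds
    \<open>\<bar>B * \<gamma>\<bar>\<close>, so the larger root \<open>c\<close> is positive for
    either sign of \<gamma>.\<close>
  define D where "D = sqrt ((B * \<gamma>)\<^sup>2 + 4 * A * B * g)"
  define c where "c = (B * \<gamma> + D) / (2 * A)"
  define \<kappa> where "\<kappa> = c\<^sup>2 * (V - U) / B"
  have ABg: "4 * A * B * g > 0" using A B assms by simp
  have D: "D > \<bar>B * \<gamma>\<bar>" unfolding D_def by (intro real_less_rsqrt) (use ABg in simp)
  hence c: "c > 0" using A by (simp add: c_def)
  have "D\<^sup>2 = (B * \<gamma>)\<^sup>2 + 4 * A * B * g" using ABg by (simp add: D_def)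
  moreover have "D = 2 * A * c - B * \<gamma>" using A by (simp add: c_def)
  ultimately have "4 * A * (A * c\<^sup>2) = 4 * A * (B * (c * \<gamma> + g))"
    by (simp add: power2_eq_square algebra_simps)
  hence Ac: "A * c\<^sup>2 = B * (c * \<gamma> + g)" using A by simp
  have kB: "\<kappa> * B = c\<^sup>2 * (V - U)" using B by (simp add: \<kappa>_def)
  have "B * (c * \<gamma> + g + \<kappa> * x\<^sup>2) = A * c\<^sup>2 + (\<kappa> * B) * x\<^sup>2" unfolding Ac by (simp add: algebra_simps)
  also have "\<dots> = B * (c\<^sup>2 * U)" unfolding kB by (simp add: A_def B_def algebra_simps)
  finally have x: "c * \<gamma> + g + \<kappa> * x\<^sup>2 = c\<^sup>2 * U" using B by simp
  have "B * (c * \<gamma> + g + \<kappa> * y\<^sup>2) = A * c\<^sup>2 + (\<kappa> * B) * y\<^sup>2" unfolding Ac by (simp add: algebra_simps)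
  also have "\<dots> = B * (c\<^sup>2 * V)" unfolding kB by (simp add: A_def B_def algebra_simps)
  finally have y: "c * \<gamma> + g + \<kappa> * y\<^sup>2 = c\<^sup>2 * V" using B by simp
  have "disp g h \<kappa> \<gamma> c x" "disp g h \<kappa> \<gamma> c y"
    unfolding disp_def x y using t by (simp_all add: U_def V_def)
  moreover have "\<kappa> > 0" using c UV B by (simp add: \<kappa>_def)
  ultimately show ?thesis using that c by blast
qed

lemma disp_sign_flip: "disp g h \<kappa> (- \<gamma>) (- c) \<xi> = disp g h \<kappa> \<gamma> c \<xi>"
  by (simp add: disp_def)

section \<open>Dimension of the kernel at a phase speed\<close>

lemma dim_kerL_at_speed:
  assumes "\<sigma> > 0" "s \<ge> 0" "g > 0" "\<kappa> \<ge> 0" "h > 0" "j \<noteq> 0"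
    and c: "c = Omega g h \<kappa> \<gamma> (of_int j) / of_int j"
  shows "dim (kerL \<sigma> s g h \<kappa> \<gamma> c) = 2 * card (disp_modes g h \<kappa> \<gamma> c)"
    and "\<bar>j\<bar> \<in> disp_modes g h \<kappa> \<gamma> c" and "c \<noteq> 0"
proof -
  have d: "c * of_int j > 0" "disp g h \<kappa> \<gamma> c (of_int j)"
    using Omega_speed_iff[OF assms(3-5), of "of_int j" \<gamma> c] assms(6) c by auto
  thus "c \<noteq> 0" by auto
  thus "dim (kerL \<sigma> s g h \<kappa> \<gamma> c) = 2 * card (disp_modes g h \<kappa> \<gamma> c)"
    by (intro dim_kerL disp_modes_card_le_2 assms)
  show "\<bar>j\<bar> \<in> disp_modes g h \<kappa> \<gamma> c" using d(2) assms(6) by (auto simp: disp_modes_def abs_if)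
qed

text \<open>The mode \<open>\<bar>j\<bar>\<close> is always present, so there are one or two modes,
  and a second one forces one of the two cases by \<open>disp_two_solutions\<close>. Outside these
  cases the dimension is thus two.\<close>

lemma dim_kerL_dichotomy:
  assumes "\<sigma> > 0" "s \<ge> 0" "g > 0" "\<kappa> \<ge> 0" "h > 0" "j \<noteq> 0"
    and c: "c = Omega g h \<kappa> \<gamma> (of_int j) / of_int j"
  shows "dim (kerL \<sigma> s g h \<kappa> \<gamma> c) = 2 \<or>
    dim (kerL \<sigma> s g h \<kappa> \<gamma> c) = 4 \<and> (case_i g h \<kappa> \<gamma> c \<or> case_ii h \<kappa>)"
proof -
  let ?S = "disp_modes g h \<kappa> \<gamma> c"
  note D = dim_kerL_at_speed[OF assms]
  have S: "finite ?S" "card ?S \<le> 2" using disp_modes_card_le_2 assms(5) D(3) by auto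
  have "card ?S \<ge> 1" using S D(2) by (metis One_nat_def Suc_leI card_gt_0_iff empty_iff)
  moreover have "case_i g h \<kappa> \<gamma> c \<or> case_ii h \<kappa>" if two: "card ?S = 2"
  proof -
    obtain x y where xy: "?S = {x, y}" "x \<noteq> y" using two unfolding card_2_iff by blast
    have *: "case_i g h \<kappa> \<gamma> c \<or> case_ii h \<kappa>" if "u \<in> ?S" "v \<in> ?S" "u < v" for u v
      using disp_two_solutions[OF assms(3,5) D(3), of "of_int u" "of_int v" \<kappa> \<gamma>] that
      by (simp add: disp_modes_def)
    show ?thesis using xy *[of x y] *[of y x] by (cases x y rule: linorder_cases) auto
  qed
  ultimately show ?thesis using S(2) D(1) by (cases "card ?S = 2") auto
qed

lemma exists_resonance:
  fixes j js :: int
  assumes "\<sigma> > 0" "s \<ge> 0" "1 \<le> \<bar>js\<bar>" "\<bar>js\<bar> < \<bar>j\<bar>" "sgn j = sgn js" "g > 0" "h > 0"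
  obtains \<kappa> c where "\<kappa> > 0" "Omega g h \<kappa> \<gamma> (of_int j) / of_int j = c"
    "Omega g h \<kappa> \<gamma> (of_int js) / of_int js = c" "dim (kerL \<sigma> s g h \<kappa> \<gamma> c) = 4"
proof -
  have nz: "j \<noteq> 0" "js \<noteq> 0" using assms(3,4) by auto
  \<comment> \<open>The common sign of both modes. The problem is solved for positive modes with
    vorticity \<open>e * \<gamma>\<close> and speed \<open>c > 0\<close>; reflection turns this into
    speed \<open>e * c\<close> for vorticity \<gamma>.\<close>
  define e where "e = real_of_int (sgn js)"
  have e: "e * e = 1" "of_int js = e * of_int \<bar>js\<bar>" "of_int j = e * of_int \<bar>j\<bar>" "e = 1 \<or> e = - 1"
    using nz assms(5) by (auto simp: e_def sgn_if abs_if split: if_splits)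
  have "0 < real_of_int \<bar>js\<bar>" "real_of_int \<bar>js\<bar> < real_of_int \<bar>j\<bar>"
    using assms(3,4) by (simp_all only: of_int_less_iff of_int_0_less_iff)
  then obtain \<kappa> c where kc: "\<kappa> > 0" "c > 0" "disp g h \<kappa> (e * \<gamma>) c (of_int \<bar>js\<bar>)" "disp g h \<kappa> (e * \<gamma>) c (of_int \<bar>j\<bar>)"
    using exists_resonant_tension[OF assms(6,7)] by blast
  have d: "disp g h \<kappa> \<gamma> (e * c) (of_int k)" if "disp g h \<kappa> (e * \<gamma>) c (of_int \<bar>k\<bar>)" for k :: int
    using that e(4) disp_sign_flip[of g h \<kappa> "- \<gamma>" c] by (auto simp: abs_if split: if_splits)
  have O: "Omega g h \<kappa> \<gamma> (of_int k) / of_int k = e * c"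
    if "k \<noteq> 0" "of_int k = e * of_int \<bar>k\<bar>" "disp g h \<kappa> (e * \<gamma>) c (of_int \<bar>k\<bar>)" for k :: int
  proof -
    have "e * of_int k = (e * e) * of_int \<bar>k\<bar>" by (subst that(2)) (simp only: mult.assoc)
    hence "e * of_int k = of_int \<bar>k\<bar>" unfolding e(1) by simp
    moreover have "c * of_int \<bar>k\<bar> > 0" using kc(2) that(1) by simp
    moreover have "e * c * of_int k = c * (e * of_int k)" by (simp only: mult_ac)
    ultimately have "e * c * of_int k > 0" by (simp only:)
    moreover have "Omega g h \<kappa> \<gamma> (of_int k) / of_int k = e * c
        \<longleftrightarrow> e * c * of_int k > 0 \<and> disp g h \<kappa> \<gamma> (e * c) (of_int k)"
      by (rule Omega_speed_iff) (use assms(6,7) kc(1) that(1) in simp_all)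
    ultimately show ?thesis using d[OF that(3)] by blast
  qed
  have Oj: "Omega g h \<kappa> \<gamma> (of_int j) / of_int j = e * c"
    and Ojs: "Omega g h \<kappa> \<gamma> (of_int js) / of_int js = e * c"
    using O nz e kc by auto
  let ?S = "disp_modes g h \<kappa> \<gamma> (e * c)"
  note D = dim_kerL_at_speed[OF assms(1,2,6) less_imp_le[OF kc(1)] assms(7) nz(1) Oj[symmetric]]
    dim_kerL_at_speed[OF assms(1,2,6) less_imp_le[OF kc(1)] assms(7) nz(2) Ojs[symmetric]]
  have S: "finite ?S" "card ?S \<le> 2" using disp_modes_card_le_2 assms(7) D(3) by auto
  \<comment> \<open>Two distinct modes are present and at most two are possible.\<close>
  have "card {\<bar>js\<bar>, \<bar>j\<bar>} \<le> card ?S" using S D by (intro card_mono) auto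
  hence "card ?S = 2" using S(2) assms(4) by simp
  hence "dim (kerL \<sigma> s g h \<kappa> \<gamma> (e * c)) = 4" using D(1) by simp
  thus ?thesis using that kc Oj Ojs by blast
qed

theorem proposition1p2:
  fixes \<sigma> s :: real
  assumes "\<sigma> > 0" and "s \<ge> 7/2" and "s + 1/2 \<in> \<nat>"
  shows "(\<forall>(g::real) (\<kappa>::real) (h::ereal) (\<gamma>::real) (js::int) (cs::real).
            g > 0 \<longrightarrow> \<kappa> \<ge> 0 \<longrightarrow> h > 0 \<longrightarrow> js \<noteq> 0 \<longrightarrow>
            cs = Omega g h \<kappa> \<gamma> (of_int js) / of_int js \<longrightarrow>
            (case_i g h \<kappa> \<gamma> cs \<or> case_ii h \<kappa> \<longrightarrow>
               dim (kerL \<sigma> s g h \<kappa> \<gamma> cs) = 2 \<or> dim (kerL \<sigma> s g h \<kappa> \<gamma> cs) = 4)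
            \<and> (\<not> (case_i g h \<kappa> \<gamma> cs \<or> case_ii h \<kappa>) \<longrightarrow>
               dim (kerL \<sigma> s g h \<kappa> \<gamma> cs) = 2))
       \<and> (\<forall>(js::int) (j::int) (g::real) (h::ereal) (\<gamma>::real).
            1 \<le> \<bar>js\<bar> \<longrightarrow> \<bar>js\<bar> < \<bar>j\<bar> \<longrightarrow> sgn j = sgn js \<longrightarrow> g > 0 \<longrightarrow> h > 0 \<longrightarrow>
            (\<exists>(\<kappa>::real) (cs::real). \<kappa> > 0
               \<and> Omega g h \<kappa> \<gamma> (of_int j) / of_int j = cs
               \<and> Omega g h \<kappa> \<gamma> (of_int js) / of_int js = cs
               \<and> dim (kerL \<sigma> s g h \<kappa> \<gamma> cs) = 4))"
proof -
  have s: "s \<ge> 0" using assms(2) by simp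
  show ?thesis
  proof (rule conjI; intro allI impI)
    fix g \<kappa> :: real and h :: ereal and \<gamma> :: real and js :: int and cs :: real
    assume A: "g > 0" "\<kappa> \<ge> 0" "h > 0" "js \<noteq> 0" "cs = Omega g h \<kappa> \<gamma> (of_int js) / of_int js"
    show "(case_i g h \<kappa> \<gamma> cs \<or> case_ii h \<kappa> \<longrightarrow>
             dim (kerL \<sigma> s g h \<kappa> \<gamma> cs) = 2 \<or> dim (kerL \<sigma> s g h \<kappa> \<gamma> cs) = 4)
          \<and> (\<not> (case_i g h \<kappa> \<gamma> cs \<or> case_ii h \<kappa>) \<longrightarrow> dim (kerL \<sigma> s g h \<kappa> \<gamma> cs) = 2)"
      using dim_kerL_dichotomy[OF assms(1) s A] by blast
  next
    fix js j :: int and g :: real and h :: ereal and \<gamma> :: real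
    assume B: "1 \<le> \<bar>js\<bar>" "\<bar>js\<bar> < \<bar>j\<bar>" "sgn j = sgn js" "g > 0" "h > 0"
    obtain \<kappa> c where "\<kappa> > 0" "Omega g h \<kappa> \<gamma> (of_int j) / of_int j = c"
      "Omega g h \<kappa> \<gamma> (of_int js) / of_int js = c" "dim (kerL \<sigma> s g h \<kappa> \<gamma> c) = 4"
      by (rule exists_resonance[OF assms(1) s B])
    thus "\<exists>\<kappa> cs. \<kappa> > 0 \<and> Omega g h \<kappa> \<gamma> (of_int j) / of_int j = cs
        \<and> Omega g h \<kappa> \<gamma> (of_int js) / of_int js = cs \<and> dim (kerL \<sigma> s g h \<kappa> \<gamma> cs) = 4"
      by blast
  qed
qed

end
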